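(* Let $n\ge 2$ and let $\Omega\subset\mathbb{R}^n$ be a domain. Assume $p>1$ and $b,c,q,r\in\mathbb{R}$ satisfy $bc\ge0$ and $(b,c,q,r)\in W_1\cup W_2\cup W_3\cup W_4$ (sets defined in the context). If $v\in C^2(\Omega)$ is a positive solution of $$\Delta_p v+b|\nabla v|^q+cv^r=0\quad\text{in }\Omega,$$ then for any $x\in\Omega$, $$|\nabla\ln v(x)|\le C(n,p,q,r)\,d(x,\partial\Omega)^{-1},$$ where the constant $C(n,p,q,r)$ depends only on $n,p,q,r$.
   Context: $\Delta_p v=\operatorname{div}(|\nabla v|^{p-2}\nabla v)$; solutions are understood in the weak sense: $-\int|\nabla v|^{p-2}\langle\nabla v,\nabla\psi\rangle+b\int|\nabla v|^q\psi+c\int v^r\psi=0$ for all $\psi\in C_0^\infty(\Omega)$. $d$ is the Euclidean distance. The regions are \begin{align*} W_1&=\left\{(b,c,q,r): b\left(\tfrac{n+1}{n-1}-\tfrac{q}{p-1}\right)\ge 0 \ \text{and}\ c\left(\tfrac{n+1}{n-1}-\tfrac{r}{p-1}\right)\ge 0\right\},\\ W_2&=\left\{(b,c,q,r): b\left(\tfrac{n+1}{n-1}-\tfrac{q}{p-1}\right)\ge 0 \ \text{and}\ \left|\tfrac{n+1}{n-1}-\tfrac{r}{p-1}\right|<\tfrac{2}{n-1}\right\},\\ W_3&=\left\{(b,c,q,r): \left|\tfrac{n+1}{n-1}-\tfrac{q}{p-1}\right|<\tfrac{2}{n-1} \ \text{and}\ c\left(\tfrac{n+1}{n-1}-\tfrac{r}{p-1}\right)\ge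 0\right\},\\ W_4&=\left\{(b,c,q,r): \left(\tfrac{n+1}{n-1}-\tfrac{q}{p-1}\right)^2+\left(\tfrac{n+1}{n-1}-\tfrac{r}{p-1}\right)^2<\tfrac{4}{(n-1)^2}\right\}. \end{align*} *)

theory Defs
  imports "HOL-Analysis.Analysis"
begin

definition grad :: "('a::euclidean_space \<Rightarrow> real) \<Rightarrow> 'a \<Rightarrow> 'a" where
  "grad f x = (THE D. GDERIV f x :> D)"

text \<open>Intended for open \<open>S\<close>: \<open>f\<close> is of class \<open>C\<^sup>k\<close> on \<open>S\<close>.
  Differentiability together with continuous first partial derivatives is
  equivalent to the usual \<open>C\<^sup>1\<close>, and so on recursively.\<close>

primrec Ck_on :: "nat \<Rightarrow> ('a::euclidean_space \<Rightarrow> real) \<Rightarrow> 'a set \<Rightarrow> bool" where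
  "Ck_on 0 f S \<longleftrightarrow> continuous_on S f"
| "Ck_on (Suc k) f S \<longleftrightarrow>
     (\<forall>x\<in>S. f differentiable (at x)) \<and>
     (\<forall>i\<in>Basis. Ck_on k (\<lambda>x. frechet_derivative f (at x) i) S)"

definition test_functions :: "'a::euclidean_space set \<Rightarrow> ('a \<Rightarrow> real) set" where
  "test_functions \<Omega> =
     {\<psi>. (\<forall>k. Ck_on k \<psi> UNIV) \<and> compact (closure {x. \<psi> x \<noteq> 0}) \<and> closure {x. \<psi> x \<noteq> 0} \<subseteq> \<Omega>}"

text \<open>Real power on \<open>[0, \<infinity>)\<close> with \<open>t\<^sup>0 = 1\<close> also for \<open>t = 0\<close>, whereas \<open>0 powr 0 = 0\<close>.
  For \<open>a < 0\<close> the value at \<open>t = 0\<close> is the junk value \<open>0\<close> instead of \<open>\<infinity>\<close>.\<close>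

definition rpow :: "real \<Rightarrow> real \<Rightarrow> real" where
  "rpow t a = (if a = 0 then 1 else t powr a)"

text \<open>Weak solutions of \<open>div (|\<nabla>v|\<^bsup>p-2\<^esup> \<nabla>v) + b |\<nabla>v|\<^sup>q + c v\<^sup>r = 0\<close> in \<open>\<Omega>\<close>.
  The integrability conditions say that the three integrals exist; only the one
  for the \<open>b\<close>-term, with \<open>q < 0\<close>, is a restriction on a positive \<open>C\<^sup>1\<close> function.
  In that case \<open>|\<nabla>v|\<^sup>q = \<infinity>\<close> on the critical set of \<open>v\<close>, so existence of the
  integral forces this set to be null; as \<open>rpow\<close> does not take the value \<open>\<infinity>\<close>,
  this is required separately.
  At critical points \<open>|\<nabla>v|\<^bsup>p-2\<^esup> \<nabla>v\<close> is \<open>0\<close>, which for \<open>p > 1\<close> is its continuous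
  extension.\<close>

definition weak_solution ::
    "real \<Rightarrow> real \<Rightarrow> real \<Rightarrow> real \<Rightarrow> real \<Rightarrow> 'a::euclidean_space set \<Rightarrow> ('a \<Rightarrow> real) \<Rightarrow> bool" where
  "weak_solution p b c q r \<Omega> v \<longleftrightarrow>
     (b \<noteq> 0 \<and> q < 0 \<longrightarrow> (AE x in lborel. x \<in> \<Omega> \<longrightarrow> grad v x \<noteq> 0)) \<and>
     (\<forall>\<psi>\<in>test_functions \<Omega>.
        set_integrable lborel \<Omega> (\<lambda>x. rpow (norm (grad v x)) (p - 2) * (grad v x \<bullet> grad \<psi> x)) \<and>
        set_integrable lborel \<Omega> (\<lambda>x. b * (rpow (norm (grad v x)) q * \<psi> x)) \<and>
        set_integrable lborel \<Omega> (\<lambda>x. c * (rpow (v x) r * \<psi> x)) \<and>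
        - (LINT x:\<Omega>|lborel. rpow (norm (grad v x)) (p - 2) * (grad v x \<bullet> grad \<psi> x))
        + b * (LINT x:\<Omega>|lborel. rpow (norm (grad v x)) q * \<psi> x)
        + c * (LINT x:\<Omega>|lborel. rpow (v x) r * \<psi> x) = 0)"

text \<open>Distance to the boundary, extended-real valued so that it is \<open>\<infinity>\<close>
  (with inverse \<open>0\<close>) when \<open>\<Omega>\<close> is the whole space.\<close>

definition boundary_dist :: "'a::metric_space set \<Rightarrow> 'a \<Rightarrow> ereal" where
  "boundary_dist \<Omega> x = (INF y\<in>frontier \<Omega>. ereal (dist x y))"

definition W1 :: "real \<Rightarrow> real \<Rightarrow> (real \<times> real \<times> real \<times> real) set" where
  "W1 n p = {(b, c, q, r).
     b * ((n + 1) / (n - 1) - q / (p - 1)) \<ge> 0 \<and>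
     c * ((n + 1) / (n - 1) - r / (p - 1)) \<ge> 0}"

definition W2 :: "real \<Rightarrow> real \<Rightarrow> (real \<times> real \<times> real \<times> real) set" where
  "W2 n p = {(b, c, q, r).
     b * ((n + 1) / (n - 1) - q / (p - 1)) \<ge> 0 \<and>
     \<bar>(n + 1) / (n - 1) - r / (p - 1)\<bar> < 2 / (n - 1)}"

definition W3 :: "real \<Rightarrow> real \<Rightarrow> (real \<times> real \<times> real \<times> real) set" where
  "W3 n p = {(b, c, q, r).
     \<bar>(n + 1) / (n - 1) - q / (p - 1)\<bar> < 2 / (n - 1) \<and>
     c * ((n + 1) / (n - 1) - r / (p - 1)) \<ge> 0}"

definition W4 :: "real \<Rightarrow> real \<Rightarrow> (real \<times> real \<times> real \<times> real) set" where
  "W4 n p = {(b, c, q, r).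
     ((n + 1) / (n - 1) - q / (p - 1))\<^sup>2 + ((n + 1) / (n - 1) - r / (p - 1))\<^sup>2 < 4 / (n - 1)\<^sup>2}"

end

theory Submission
  imports Defs
begin

text \<open>
  The proof is Bernstein's method with the maximum principle, applied to \<open>w = ln v\<close> and arranged
  so that two derivatives of \<open>v\<close> suffice. At points with \<open>\<nabla>w \<noteq> 0\<close> the weak equation holds pointwise
  (\<open>weak_solution_pointwise\<close>). Dividing by \<open>v\<^bsup>p-1\<^esup> |\<nabla>w|\<^bsup>p-2\<^esup>\<close> and writing \<open>\<nu> = \<nabla>w/|\<nabla>w|\<close>, it reads
  \<open>tr H + (p - 2) H \<nu> \<bullet> \<nu> + (p - 1) |\<nabla>w|\<^sup>2 + B + D = 0\<close>, where \<open>H\<close> is the Hessian of \<open>w\<close>,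
  \<open>B = b v\<^bsup>q-p+1\<^esup> |\<nabla>w|\<^bsup>q-p+2\<^esup>\<close> and \<open>D = c v\<^bsup>r-p+1\<^esup> |\<nabla>w|\<^bsup>2-p\<^esup>\<close>.

  Let \<open>F = |\<nabla>w|\<^sup>2\<close> and apply the operator with coefficients \<open>a = I + (p - 2) \<nu> \<nu>\<^sup>T\<close> to \<open>F\<close>. Differentiating
  the equation along \<open>\<nabla>w\<close> removes the third derivatives. Up to terms containing \<open>\<nabla>F\<close>, the Hessian has
  no component in direction \<open>\<nu>\<close>, so Cauchy-Schwarz in the remaining \<open>n - 1\<close> dimensions bounds \<open>|H|\<^sup>2\<close>
  below by \<open>(X + B + D)\<^sup>2/(n - 1)\<close>, where \<open>X = (p - 1) F\<close>. The result is, up to the factor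
  \<open>2/(n - 1)\<close>, bounded below by
  \<open>X\<^sup>2 + (B + D)\<^sup>2 + (n - 1) X (s B + t D)\<close> with \<open>s = (n + 1)/(n - 1) - q/(p - 1)\<close> and
  \<open>t = (n + 1)/(n - 1) - r/(p - 1)\<close>. The four regions, together with \<open>b c \<ge> 0\<close>, make this form positive
  definite (\<open>W_coercive\<close>). Terms with \<open>\<nabla>F\<close> are absorbed (\<open>bernstein_coercivity\<close>), which leaves
  \<open>\<Sum> a\<^sub>k\<^sub>l \<partial>\<^sub>k \<partial>\<^sub>l F \<ge> \<epsilon> F\<^sup>2 - K |\<nabla>F|\<^sup>2/F\<close>. A quadratic cut-off then gives \<open>F \<le> C/\<rho>\<^sup>2\<close> at the centre
  of every ball of radius \<open>\<rho>\<close> inside \<open>\<Omega>\<close> (\<open>local_gradient_estimate\<close>).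

  Since \<open>w\<close> is only \<open>C\<^sup>2\<close>, \<open>F\<close> is only \<open>C\<^sup>1\<close>, and the inequality for \<open>F\<close> is used in the viscosity
  sense, at points where a smooth function touches \<open>F\<close> from above (\<open>gradient_square_touching\<close>). It is
  obtained there by applying the maximum principle to difference quotients of \<open>w\<close>; for these
  the equation is subtracted at two points instead of being differentiated.
\<close>

section \<open>Difference quotients and second derivatives\<close>

lemma mvt_along_direction:
  fixes f :: "'a::euclidean_space \<Rightarrow> real"
  assumes "convex B" "x \<in> B" "x + k *\<^sub>R u \<in> B"
    and der: "\<And>z. z \<in> B \<Longrightarrow> (f has_derivative f' z) (at z)"
  shows "\<exists>z\<in>B. f (x + k *\<^sub>R u) - f x = k * f' z u"
proof -
  have inB: "x + (t * k) *\<^sub>R u \<in> B" if "0 \<le> t" "t \<le> 1" for t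
  proof -
    have "(1 - t) *\<^sub>R x + t *\<^sub>R (x + k *\<^sub>R u) \<in> B"
      using assms(1-3) that by (intro convexD) auto
    then show ?thesis by (simp add: algebra_simps)
  qed
  have "\<exists>t\<in>{0<..<1::real}. f (x + (1 * k) *\<^sub>R u) - f (x + (0 * k) *\<^sub>R u)
      = f' (x + (t * k) *\<^sub>R u) (((1 - 0) * k) *\<^sub>R u)"
  proof (rule mvt_simple[of 0 1 "\<lambda>t. f (x + (t * k) *\<^sub>R u)" "\<lambda>t s. f' (x + (t * k) *\<^sub>R u) ((s * k) *\<^sub>R u)"])
    fix t :: real assume t: "0 \<le> t" "t \<le> 1"
    have "((\<lambda>t. x + (t * k) *\<^sub>R u) has_derivative (\<lambda>s. (s * k) *\<^sub>R u)) (at t within {0..1})"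
      by (auto intro!: derivative_eq_intros)
    from has_derivative_compose[OF this der[OF inB[OF t]]]
    show "((\<lambda>t. f (x + (t * k) *\<^sub>R u)) has_derivative (\<lambda>s. f' (x + (t * k) *\<^sub>R u) ((s * k) *\<^sub>R u)))
        (at t within {0..1})" .
  qed simp
  then obtain t where t: "0 < t" "t < 1"
    and eq: "f (x + k *\<^sub>R u) - f x = f' (x + (t * k) *\<^sub>R u) (k *\<^sub>R u)"
    by auto
  have z: "x + (t * k) *\<^sub>R u \<in> B" using inB t by simp
  then have "linear (f' (x + (t * k) *\<^sub>R u))"
    using der has_derivative_linear by blast
  with eq z show ?thesis by (auto simp: linear_cmul)
qed

text \<open>A \<open>C\<^sup>1\<close> function is strictly differentiable: its difference quotients converge even if
  the base point moves along with the step size. This is what lets difference quotients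
  stand in for derivatives at maximum points that depend on the step size.\<close>

lemma strict_difference_quotient:
  fixes f :: "'a::euclidean_space \<Rightarrow> real"
  assumes "open S" "y \<in> S"
    and der: "\<And>z. z \<in> S \<Longrightarrow> (f has_derivative f' z) (at z)"
    and cont: "continuous_on S (\<lambda>z. f' z u)"
    and X: "X \<longlonglongrightarrow> y" and h: "h \<longlonglongrightarrow> 0" and h0: "\<And>n. h n \<noteq> 0"
  shows "(\<lambda>n. (f (X n + h n *\<^sub>R u) - f (X n)) / h n) \<longlonglongrightarrow> f' y u"
proof (rule tendstoI)
  fix e :: real assume "e > 0"
  have "isCont (\<lambda>z. f' z u) y"
    using cont assms(1,2) continuous_on_eq_continuous_at by blast
  then have "((\<lambda>z. f' z u) \<longlongrightarrow> f' y u) (nhds y)"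
    unfolding continuous_at by (rule tendsto_at_iff_tendsto_nhds[THEN iffD1])
  from tendstoD[OF this \<open>e > 0\<close>] have "\<forall>\<^sub>F z in nhds y. dist (f' z u) (f' y u) < e" .
  moreover have "\<forall>\<^sub>F z in nhds y. z \<in> S"
    using assms(1,2) by (simp add: eventually_nhds_in_open)
  ultimately have "\<forall>\<^sub>F z in nhds y. z \<in> S \<and> dist (f' z u) (f' y u) < e"
    by eventually_elim auto
  then obtain r where "r > 0"
    and r: "\<And>z. z \<in> ball y r \<Longrightarrow> z \<in> S \<and> dist (f' z u) (f' y u) < e"
    unfolding eventually_nhds_metric by (auto simp: dist_commute)
  have Y: "(\<lambda>n. X n + h n *\<^sub>R u) \<longlonglongrightarrow> y"
    using tendsto_add[OF X tendsto_scaleR[OF h tendsto_const[of u]]] by simp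
  have "\<forall>\<^sub>F n in sequentially. X n \<in> ball y r"
       "\<forall>\<^sub>F n in sequentially. X n + h n *\<^sub>R u \<in> ball y r"
    using topological_tendstoD[OF X open_ball[of y r]] topological_tendstoD[OF Y open_ball[of y r]]
      \<open>r > 0\<close> by auto
  then show "\<forall>\<^sub>F n in sequentially. dist ((f (X n + h n *\<^sub>R u) - f (X n)) / h n) (f' y u) < e"
  proof eventually_elim
    case (elim n)
    from mvt_along_direction[OF convex_ball elim, of f f'] der r
    obtain z where "z \<in> ball y r" "f (X n + h n *\<^sub>R u) - f (X n) = h n * f' z u" by blast
    with r h0 show ?case by simp
  qed
qed

lemma second_derivative_symmetric:
  fixes f :: "'a::euclidean_space \<Rightarrow> real" and g :: "'a \<Rightarrow> 'a"
  assumes S: "open S" "y \<in> S"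
    and f: "\<And>z. z \<in> S \<Longrightarrow> (f has_derivative (\<lambda>k. g z \<bullet> k)) (at z)"
    and g: "\<And>z. z \<in> S \<Longrightarrow> (g has_derivative H z) (at z)"
    and cont: "\<And>u. continuous_on S (\<lambda>z. H z u)"
  shows "H y u \<bullet> v = u \<bullet> H y v"
proof -
  have gu: "((\<lambda>z. g z \<bullet> u) has_derivative (\<lambda>k. H z k \<bullet> u)) (at z)" if "z \<in> S" for z u
    using g[OF that] by (rule has_derivative_inner_left)
  \<comment> \<open>The mixed second difference of \<open>f\<close> over a small parallelogram is symmetric in \<open>u\<close> and \<open>v\<close>,
    and two applications of the mean value theorem turn it into a second derivative.\<close>
  have small: "\<exists>z z'. z \<in> ball y r \<and> z' \<in> ball y r \<and> H z v \<bullet> u = H z' u \<bullet> v"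
    if r: "r > 0" "ball y r \<subseteq> S" for r
  proof -
    define h where "h = r / (2 * (1 + norm u + norm v))"
    have h: "h > 0" unfolding h_def using r by (auto intro!: divide_pos_pos add_pos_nonneg)
    have hb: "h * (1 + norm u + norm v) < r"
      unfolding h_def using r by (simp add: field_simps add_pos_nonneg)
    have nu: "norm (h *\<^sub>R u) < r" "norm (h *\<^sub>R v) < r" "norm (h *\<^sub>R u + h *\<^sub>R v) < r"
    proof -
      have "h * norm u + h * norm v < r" using hb h by (simp add: algebra_simps)
      moreover have "0 \<le> h * norm u" "0 \<le> h * norm v" using h by auto
      ultimately show "norm (h *\<^sub>R u) < r" "norm (h *\<^sub>R v) < r" "norm (h *\<^sub>R u + h *\<^sub>R v) < r"
        using h order.trans[OF norm_triangle_ineq[of "h *\<^sub>R u" "h *\<^sub>R v"] order_refl]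
        unfolding norm_scaleR abs_of_pos[OF h] by linarith+
    qed
    have mixed: "\<exists>z\<in>ball y r. f (y + h *\<^sub>R u + h *\<^sub>R v) - f (y + h *\<^sub>R u) - f (y + h *\<^sub>R v) + f y
        = h * (h * (H z v \<bullet> u))"
      if "norm (h *\<^sub>R u) < r" "norm (h *\<^sub>R v) < r" "norm (h *\<^sub>R u + h *\<^sub>R v) < r" for u v
    proof -
      define B where "B = ball y r \<inter> ball (y - h *\<^sub>R v) r"
      have B: "z \<in> ball y r \<and> z + h *\<^sub>R v \<in> ball y r" if "z \<in> B" for z
        using that unfolding B_def by (simp add: dist_norm diff_diff_eq add.commute)
      have 1: "y \<in> B" "y + h *\<^sub>R u \<in> B"
      proof -
        have "norm (- (h *\<^sub>R v) - h *\<^sub>R u) = norm (h *\<^sub>R u + h *\<^sub>R v)"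
          by (metis add.commute minus_add_distrib diff_conv_add_uminus norm_minus_cancel)
        then show "y \<in> B" "y + h *\<^sub>R u \<in> B"
          using that r(1) unfolding B_def by (simp_all add: dist_norm del: norm_scaleR)
      qed
      have "\<exists>z\<in>B. (f ((y + h *\<^sub>R u) + h *\<^sub>R v) - f (y + h *\<^sub>R u)) - (f (y + h *\<^sub>R v) - f y)
          = h * (g (z + h *\<^sub>R v) \<bullet> u - g z \<bullet> u)"
      proof (rule mvt_along_direction[where f="\<lambda>z. f (z + h *\<^sub>R v) - f z", OF _ 1])
        show "convex B" unfolding B_def by (simp add: convex_Int)
        fix z assume "z \<in> B"
        with B r have z: "z \<in> S" "z + h *\<^sub>R v \<in> S" by blast+
        have "((\<lambda>z. z + h *\<^sub>R v) has_derivative (\<lambda>k. k)) (at z)"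
          by (auto intro!: derivative_eq_intros)
        from has_derivative_compose[OF this f[OF z(2)]] f[OF z(1)]
        show "((\<lambda>z. f (z + h *\<^sub>R v) - f z) has_derivative (\<lambda>k. g (z + h *\<^sub>R v) \<bullet> k - g z \<bullet> k)) (at z)"
          by (rule has_derivative_diff)
      qed
      then obtain z where z: "z \<in> B"
        and eq: "(f ((y + h *\<^sub>R u) + h *\<^sub>R v) - f (y + h *\<^sub>R u)) - (f (y + h *\<^sub>R v) - f y)
          = h * (g (z + h *\<^sub>R v) \<bullet> u - g z \<bullet> u)" by blast
      have "\<exists>z'\<in>ball y r. g (z + h *\<^sub>R v) \<bullet> u - g z \<bullet> u = h * (H z' v \<bullet> u)"
        using B[OF z] gu r by (intro mvt_along_direction[where f="\<lambda>z. g z \<bullet> u"]) auto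
      then obtain z' where "z' \<in> ball y r" "g (z + h *\<^sub>R v) \<bullet> u - g z \<bullet> u = h * (H z' v \<bullet> u)" by blast
      with eq show ?thesis by (intro bexI[of _ z']) simp_all
    qed
    obtain z where z: "z \<in> ball y r" "f (y + h *\<^sub>R u + h *\<^sub>R v) - f (y + h *\<^sub>R u) - f (y + h *\<^sub>R v) + f y
        = h * (h * (H z v \<bullet> u))" using mixed[OF nu] by blast
    obtain z' where z': "z' \<in> ball y r" "f (y + h *\<^sub>R v + h *\<^sub>R u) - f (y + h *\<^sub>R v) - f (y + h *\<^sub>R u) + f y
        = h * (h * (H z' u \<bullet> v))" using mixed[of v u] nu by (auto simp: add.commute)
    have "h * (h * (H z v \<bullet> u)) = h * (h * (H z' u \<bullet> v))"
      using z(2) z'(2) by (simp add: algebra_simps)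
    with h z(1) z'(1) show ?thesis by auto
  qed
  obtain r0 where r0: "r0 > 0" "ball y r0 \<subseteq> S" using S open_contains_ball by blast
  define r where "r n = r0 / real (Suc n)" for n
  have rpos: "r n > 0" "r n \<le> r0" for n unfolding r_def using r0 by (auto simp: field_simps)
  have "\<forall>n. \<exists>z z'. z \<in> ball y (r n) \<and> z' \<in> ball y (r n) \<and> H z v \<bullet> u = H z' u \<bullet> v"
    using small rpos r0 by (meson dual_order.trans subset_ball)
  then obtain z z' where z: "\<And>n. z n \<in> ball y (r n)" "\<And>n. z' n \<in> ball y (r n)"
    "\<And>n. H (z n) v \<bullet> u = H (z' n) u \<bullet> v" by metis
  have "r \<longlonglongrightarrow> 0" unfolding r_def using tendsto_mult_right_zero[OF LIMSEQ_inverse_real_of_nat, of r0] by (simp add: divide_inverse)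
  have conv: "x \<longlonglongrightarrow> y" if "\<And>n. x n \<in> ball y (r n)" for x
  proof (rule Lim_null[THEN iffD2], rule Lim_null_comparison[OF _ \<open>r \<longlonglongrightarrow> 0\<close>])
    show "\<forall>\<^sub>F n in sequentially. norm (x n - y) \<le> r n"
      using that by (intro always_eventually allI) (simp add: dist_norm norm_minus_commute less_imp_le)
  qed
  have "isCont (\<lambda>z. H z v \<bullet> u) y" for u v
    using cont[of v] S by (auto simp: continuous_on_eq_continuous_at intro!: continuous_intros)
  then have "(\<lambda>n. H (z n) v \<bullet> u) \<longlonglongrightarrow> H y v \<bullet> u" "(\<lambda>n. H (z' n) u \<bullet> v) \<longlonglongrightarrow> H y u \<bullet> v"
    using conv z(1,2) by (auto intro: isCont_tendsto_compose)
  with z(3) have "H y v \<bullet> u = H y u \<bullet> v" by (simp add: LIMSEQ_unique)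
  then show ?thesis by (simp add: inner_commute)
qed

lemma second_derivative_nonpos_at_max:
  fixes f f' :: "real \<Rightarrow> real"
  assumes "d > 0" and max: "\<And>t. \<bar>t\<bar> < d \<Longrightarrow> f t \<le> f 0"
    and f: "\<And>t. \<bar>t\<bar> < d \<Longrightarrow> (f has_real_derivative f' t) (at t)"
    and f': "(f' has_real_derivative L) (at 0)"
  shows "f' 0 = 0" "L \<le> 0"
proof -
  show f'0: "f' 0 = 0"
    using DERIV_local_max[OF f[of 0], of d] assms by auto
  show "L \<le> 0"
  proof (rule ccontr)
    assume "\<not> L \<le> 0"
    then obtain e where e: "e > 0" "\<And>t. t > 0 \<Longrightarrow> t < e \<Longrightarrow> f' 0 < f' t"
      using DERIV_pos_inc_right[OF f'] by auto
    define t where "t = min (d/2) (e/2)"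
    have t: "0 < t" "t < d" "t < e" using e assms(1) by (auto simp: t_def)
    have "f 0 < f t"
    proof (rule DERIV_pos_imp_increasing_open[OF t(1)])
      fix x assume "0 < x" "x < t"
      then show "\<exists>y. (f has_real_derivative y) (at x) \<and> 0 < y"
        using f[of x] e(2)[of x] f'0 t by auto
    next
      show "continuous_on {0..t} f"
        using t by (intro continuous_at_imp_continuous_on ballI DERIV_isCont[OF f]) auto
    qed
    with max[of t] t show False by auto
  qed
qed

section \<open>Smooth bump functions\<close>

text \<open>The functions \<open>e\<^bsup>-1/t\<^esup> t\<^bsup>-m\<^esup>\<close> on \<open>t > 0\<close>, extended by \<open>0\<close>. The derivative of each is a linear
  combination of others in the family, so all of them are smooth on the whole line.\<close>

definition flat_exp :: "nat \<Rightarrow> real \<Rightarrow> real" where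
  "flat_exp m t = (if t > 0 then exp (- (1 / t)) / t ^ m else 0)"

lemma flat_exp_tendsto_0: "(flat_exp m \<longlongrightarrow> 0) (at_right 0)"
proof -
  have "((\<lambda>t. inverse t ^ m / exp (inverse t)) \<longlongrightarrow> (0::real)) (at_right 0)"
    using filterlim_compose[OF tendsto_power_div_exp_0[of m] filterlim_inverse_at_top_right] .
  then show ?thesis
    by (rule Lim_transform_eventually)
      (auto simp: flat_exp_def eventually_at_right_less exp_minus divide_inverse power_inverse
        mult.commute intro!: eventually_at_rightI[of 0 1])
qed

lemma flat_exp_has_derivative:
  "(flat_exp m has_real_derivative flat_exp (m + 2) t - real m * flat_exp (m + 1) t) (at t)"
proof -
  consider "t > 0" | "t < 0" | "t = 0" by linarith
  then show ?thesis
  proof cases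
    case 1
    have "((\<lambda>t. exp (- (1 / t)) / t ^ m) has_real_derivative
        flat_exp (m + 2) t - real m * flat_exp (m + 1) t) (at t)"
      using 1
      by (auto intro!: derivative_eq_intros simp: flat_exp_def, cases m) (auto simp: field_simps power2_eq_square)
    then show ?thesis
      by (rule has_field_derivative_transform_within_open[where S="{0<..}"])
        (use 1 in \<open>auto simp: flat_exp_def\<close>)
  next
    case 2
    have "((\<lambda>t. 0) has_real_derivative flat_exp (m + 2) t - real m * flat_exp (m + 1) t) (at t)"
      using 2 by (simp add: flat_exp_def)
    then show ?thesis
      by (rule has_field_derivative_transform_within_open[where S="{..<0}"])
        (use 2 in \<open>auto simp: flat_exp_def\<close>)
  next
    case 3
    have "((\<lambda>s. flat_exp m s / s) \<longlongrightarrow> 0) (at_right 0)"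
      using flat_exp_tendsto_0[of "Suc m"]
      by (rule Lim_transform_eventually)
        (auto simp: flat_exp_def field_simps intro!: eventually_at_rightI[of 0 1])
    moreover have "((\<lambda>s. flat_exp m s / s) \<longlongrightarrow> 0) (at_left 0)"
      by (rule Lim_transform_eventually[OF tendsto_const])
        (auto simp: flat_exp_def intro!: eventually_at_leftI[of "-1"])
    ultimately have "((\<lambda>s. flat_exp m s / s) \<longlongrightarrow> 0) (at 0)"
      by (simp add: filterlim_split_at)
    with 3 show ?thesis
      by (simp add: has_field_derivative_iff flat_exp_def)
  qed
qed

text \<open>The algebra of functions generated by constants, coordinates centred at \<open>x0\<close> and the
  functions \<open>flat_exp m\<close> composed with \<open>e\<^sup>2 - |x - x0|\<^sup>2\<close>. It is closed under partial derivatives,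
  hence consists of smooth functions, and it contains a bump function.\<close>
inductive smooth_gen :: "'a::euclidean_space \<Rightarrow> real \<Rightarrow> ('a \<Rightarrow> real) \<Rightarrow> bool" for x0 e where
  const: "smooth_gen x0 e (\<lambda>x. k)"
| coord: "smooth_gen x0 e (\<lambda>x. (x - x0) \<bullet> u)"
| flat: "smooth_gen x0 e (\<lambda>x. flat_exp m (e\<^sup>2 - (norm (x - x0))\<^sup>2))"
| add: "smooth_gen x0 e f \<Longrightarrow> smooth_gen x0 e g \<Longrightarrow> smooth_gen x0 e (\<lambda>x. f x + g x)"
| mult: "smooth_gen x0 e f \<Longrightarrow> smooth_gen x0 e g \<Longrightarrow> smooth_gen x0 e (\<lambda>x. f x * g x)"

lemma smooth_gen_derivative:
  assumes "smooth_gen x0 e f"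
  shows "\<exists>f'. (\<forall>x. (f has_derivative f' x) (at x)) \<and> (\<forall>u. smooth_gen x0 e (\<lambda>x. f' x u))"
  using assms
proof induction
  case (const k)
  show ?case by (intro exI[of _ "\<lambda>x u. 0"]) (auto intro: smooth_gen.const)
next
  case (coord u)
  show ?case
    by (intro exI[of _ "\<lambda>x k. k \<bullet> u"]) (auto intro!: smooth_gen.const derivative_eq_intros)
next
  case (flat m)
  let ?\<rho> = "\<lambda>x. e\<^sup>2 - (norm (x - x0))\<^sup>2"
  have \<rho>: "(?\<rho> has_derivative (\<lambda>k. - 2 * ((x - x0) \<bullet> k))) (at x)" for x
    unfolding power2_norm_eq_inner by (auto intro!: derivative_eq_intros simp: inner_commute)
  have "((\<lambda>x. flat_exp m (?\<rho> x)) has_derivative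
      (\<lambda>k. (flat_exp (m + 2) (?\<rho> x) + (- real m) * flat_exp (m + 1) (?\<rho> x)) * (- 2 * ((x - x0) \<bullet> k)))) (at x)" for x
    using has_derivative_compose[OF \<rho> flat_exp_has_derivative[unfolded has_field_derivative_def]]
    by simp
  moreover have "smooth_gen x0 e (\<lambda>x. (flat_exp (m + 2) (?\<rho> x)
      + (- real m) * flat_exp (m + 1) (?\<rho> x)) * (- 2 * ((x - x0) \<bullet> k)))" for k
    by (intro smooth_gen.intros)
  ultimately show ?case
    by (intro exI[of _ "\<lambda>x k. (flat_exp (m + 2) (?\<rho> x)
      + (- real m) * flat_exp (m + 1) (?\<rho> x)) * (- 2 * ((x - x0) \<bullet> k))"] conjI allI)
next
  case (add f g)
  then obtain f' g' where "\<forall>x. (f has_derivative f' x) (at x)" "\<forall>u. smooth_gen x0 e (\<lambda>x. f' x u)"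
    "\<forall>x. (g has_derivative g' x) (at x)" "\<forall>u. smooth_gen x0 e (\<lambda>x. g' x u)" by blast
  then show ?case
    by (intro exI[of _ "\<lambda>x u. f' x u + g' x u"]) (auto intro!: smooth_gen.add has_derivative_add)
next
  case (mult f g)
  then obtain f' g' where "\<forall>x. (f has_derivative f' x) (at x)" "\<forall>u. smooth_gen x0 e (\<lambda>x. f' x u)"
    "\<forall>x. (g has_derivative g' x) (at x)" "\<forall>u. smooth_gen x0 e (\<lambda>x. g' x u)" by blast
  with mult.hyps show ?case
    by (intro exI[of _ "\<lambda>x u. f x * g' x u + f' x u * g x"])
      (auto intro!: smooth_gen.add smooth_gen.mult has_derivative_mult)
qed

lemma smooth_gen_Ck: "smooth_gen x0 e f \<Longrightarrow> Ck_on k f UNIV"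
proof (induction k arbitrary: f)
  case 0
  then obtain f' where "\<And>x. (f has_derivative f' x) (at x)" using smooth_gen_derivative by blast
  then show ?case
    by (auto intro!: continuous_at_imp_continuous_on intro: has_derivative_continuous)
next
  case (Suc k)
  from smooth_gen_derivative[OF Suc.prems] obtain f'
    where f': "\<And>x. (f has_derivative f' x) (at x)" "\<And>u. smooth_gen x0 e (\<lambda>x. f' x u)" by blast
  then have "frechet_derivative f (at x) = f' x" for x
    using frechet_derivative_at by metis
  with f' Suc.IH show ?case by (auto simp: differentiable_def)
qed

text \<open>The standard smooth bump; for \<open>e > 0\<close> it is positive exactly on the open ball of radius \<open>e\<close> about \<open>x0\<close>.\<close>

definition bump :: "'a::euclidean_space \<Rightarrow> real \<Rightarrow> 'a \<Rightarrow> real" where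
  "bump x0 e x = flat_exp 0 (e\<^sup>2 - (norm (x - x0))\<^sup>2)"

lemma bump_pos_iff: "e > 0 \<Longrightarrow> 0 < bump x0 e x \<longleftrightarrow> x \<in> ball x0 e"
  unfolding bump_def flat_exp_def
  using power2_less_imp_less[of "norm (x - x0)" e] power_strict_mono[of "norm (x - x0)" e 2]
  by (auto simp: dist_norm norm_minus_commute)

lemma bump_nonneg: "0 \<le> bump x0 e x"
  by (simp add: bump_def flat_exp_def)

lemma bump_eq_0: "e > 0 \<Longrightarrow> x \<notin> ball x0 e \<Longrightarrow> bump x0 e x = 0"
  using bump_pos_iff[of e x0 x] bump_nonneg[of x0 e x] by linarith

lemma linear_functional_eq_inner:
  fixes L :: "'a::euclidean_space \<Rightarrow> real"
  assumes "linear L"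
  shows "L k = (\<Sum>i\<in>Basis. L i *\<^sub>R i) \<bullet> k"
proof -
  have "L k = L (\<Sum>i\<in>Basis. (k \<bullet> i) *\<^sub>R i)" by (simp add: euclidean_representation)
  also have "\<dots> = (\<Sum>i\<in>Basis. (k \<bullet> i) * L i)"
    using assms by (simp add: linear_sum linear_cmul)
  also have "\<dots> = (\<Sum>i\<in>Basis. L i *\<^sub>R i) \<bullet> k" unfolding inner_sum_left inner_scaleR_left
    by (intro sum.cong) (auto simp: inner_commute)
  finally show ?thesis .
qed

lemma bump_C1:
  shows "\<exists>D. (\<forall>x. (bump x0 e has_derivative (\<lambda>k. D x \<bullet> k)) (at x)) \<and> continuous_on UNIV D"
proof -
  have "smooth_gen x0 e (bump x0 e)" unfolding bump_def by (rule smooth_gen.flat)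
  from smooth_gen_derivative[OF this] obtain f' where
    f': "\<And>x. (bump x0 e has_derivative f' x) (at x)" "\<And>u. smooth_gen x0 e (\<lambda>x. f' x u)" by blast
  define D where "D x = (\<Sum>i\<in>Basis. f' x i *\<^sub>R i)" for x
  have "f' x k = D x \<bullet> k" for x k
    unfolding D_def by (rule linear_functional_eq_inner[OF has_derivative_linear[OF f'(1)]])
  then have "f' x = (\<lambda>k. D x \<bullet> k)" for x by blast
  moreover have "continuous_on UNIV D" unfolding D_def
    using smooth_gen_Ck[OF f'(2), of 0] by (intro continuous_intros) auto
  ultimately show ?thesis using f'(1) by metis
qed

lemma bump_test_function:
  assumes "e > 0" "cball x0 e \<subseteq> \<Omega>"
  shows "bump x0 e \<in> test_functions \<Omega>"
proof -
  have "{x. bump x0 e x \<noteq> 0} = ball x0 e"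
    using bump_pos_iff[OF assms(1), of x0] bump_eq_0[OF assms(1), of _ x0] by force
  moreover have "Ck_on k (bump x0 e) UNIV" for k
    unfolding bump_def by (rule smooth_gen_Ck[OF smooth_gen.flat])
  ultimately show ?thesis using assms by (simp add: test_functions_def)
qed

section \<open>From weak solutions to the pointwise equation\<close>

lemma grad_eqI: "(f has_derivative (\<lambda>k. D \<bullet> k)) (at x) \<Longrightarrow> grad f x = D"
proof -
  assume D: "(f has_derivative (\<lambda>k. D \<bullet> k)) (at x)"
  show ?thesis unfolding grad_def gderiv_def
  proof (rule the_equality)
    show "(f has_derivative (\<lambda>k. k \<bullet> D)) (at x)" using D by (simp add: inner_commute)
    fix E assume "(f has_derivative (\<lambda>k. k \<bullet> E)) (at x)"
    with D have "(\<lambda>k. D \<bullet> k) = (\<lambda>k. k \<bullet> E)" by (rule has_derivative_unique)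
    then have "D \<bullet> k = E \<bullet> k" for k by (metis inner_commute)
    then show "E = D" by (metis vector_eq_rdot)
  qed
qed

text \<open>The form of the divergence theorem needed for integration by parts. By translation
  invariance the integral of every difference quotient of \<open>f\<close> vanishes, and the
  quotients converge dominatedly to the directional derivative.\<close>

lemma integral_derivative_compact_support:
  fixes f :: "'a::euclidean_space \<Rightarrow> real"
  assumes f: "\<And>x. (f has_derivative f' x) (at x)"
    and cont: "continuous_on UNIV (\<lambda>x. f' x u)"
    and supp: "\<And>x. x \<notin> cball x0 e \<Longrightarrow> f x = 0"
  shows "integrable lborel (\<lambda>x. f' x u)" "(LINT x|lborel. f' x u) = 0"
proof -
  have supp': "f' x u = 0" if "x \<notin> cball x0 e" for x
  proof -
    have "((\<lambda>x. 0) has_derivative (\<lambda>k. 0)) (at x)" by simp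
    then have "(f has_derivative (\<lambda>k. 0)) (at x)"
      by (rule has_derivative_transform_within_open[OF _ open_Compl[OF closed_cball[of x0 e]]])
        (use that supp in auto)
    with f[of x] show ?thesis by (metis has_derivative_unique)
  qed
  have "bounded ((\<lambda>x. f' x u) ` cball x0 e)"
    using cont by (intro compact_imp_bounded compact_continuous_image) (auto intro: continuous_on_subset)
  then obtain M0 where M0: "\<And>x. x \<in> cball x0 e \<Longrightarrow> \<bar>f' x u\<bar> \<le> M0"
    unfolding bounded_iff by (metis imageI real_norm_def)
  define M where "M = max M0 0"
  have M: "\<bar>f' x u\<bar> \<le> M" for x using M0[of x] supp'[of x] by (cases "x \<in> cball x0 e") (auto simp: M_def)
  define h where "h n = 1 / real (Suc n)" for n
  have h: "h n > 0" "h n \<le> 1" for n by (auto simp: h_def)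
  have h0: "h \<longlonglongrightarrow> 0" unfolding h_def using LIMSEQ_inverse_real_of_nat by (simp add: inverse_eq_divide)
  define q where "q n x = (f (x + h n *\<^sub>R u) - f x) / h n" for n x
  have fc: "continuous_on UNIV f"
    using f by (auto intro!: continuous_at_imp_continuous_on intro: has_derivative_continuous)
  have fint: "integrable lborel f"
  proof -
    have "integrable lborel (\<lambda>x. indicator (cball x0 e) x *\<^sub>R f x)"
      by (rule borel_integrable_compact) (auto intro: continuous_on_subset[OF fc])
    moreover have "(\<lambda>x. indicator (cball x0 e) x *\<^sub>R f x) = f"
      using supp by (auto simp: indicator_def fun_eq_iff)
    ultimately show ?thesis by simp
  qed
  have shift: "integrable lborel (\<lambda>x. f (x + a))" "(LINT x|lborel. f (x + a)) = (LINT x|lborel. f x)" for a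
  proof -
    have meas: "f \<in> borel_measurable borel" using fc by (rule borel_measurable_continuous_onI)
    show "integrable lborel (\<lambda>x. f (x + a))"
      using fint integrable_distr_eq[of "(+) a" lborel borel f] meas lborel_distr_plus[of a]
      by (simp add: add.commute)
    show "(LINT x|lborel. f (x + a)) = (LINT x|lborel. f x)"
      using integral_distr[of "(+) a" lborel borel f] meas lborel_distr_plus[of a]
      by (simp add: add.commute)
  qed
  have q0: "(LINT x|lborel. q n x) = 0" for n
    unfolding q_def using shift fint by simp
  have lim: "(\<lambda>n. q n x) \<longlonglongrightarrow> f' x u" for x
  proof -
    have "((\<lambda>t. x + t *\<^sub>R u) has_derivative (\<lambda>t. t *\<^sub>R u)) (at 0)"
      by (auto intro!: derivative_eq_intros)
    moreover have "(f has_derivative f' x) (at (x + 0 *\<^sub>R u))" using f by simp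
    ultimately have "((\<lambda>t. f (x + t *\<^sub>R u)) has_derivative (\<lambda>t. f' x (t *\<^sub>R u))) (at 0)"
      by (rule has_derivative_compose)
    then have "((\<lambda>t. f (x + t *\<^sub>R u)) has_real_derivative f' x u) (at 0)"
      using has_derivative_linear[OF f[of x]]
      by (simp add: has_field_derivative_def linear_cmul mult_commute_abs)
    then have "((\<lambda>t. (f (x + t *\<^sub>R u) - f x) / t) \<longlongrightarrow> f' x u) (at 0)"
      by (simp add: has_field_derivative_iff)
    moreover have "filterlim h (at 0) sequentially"
      using h0 h by (auto simp: filterlim_at less_imp_neq[OF h(1), symmetric])
    ultimately show ?thesis unfolding q_def by (rule filterlim_compose)
  qed
  \<comment> \<open>Steps are at most \<open>1\<close>, so all quotients are supported in one larger ball.\<close>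
  define w where "w x = indicator (cball x0 (e + norm u)) x * M" for x :: 'a
  have dom: "norm (q n x) \<le> w x" for n x
  proof (cases "x \<in> cball x0 (e + norm u)")
    case True
    obtain z where "f (x + h n *\<^sub>R u) - f x = h n * f' z u"
      using mvt_along_direction[of UNIV x "h n" u f f'] f by auto
    then have "q n x = f' z u" unfolding q_def using h[of n] by simp
    with M True show ?thesis by (simp add: w_def)
  next
    case False
    have "dist x (x + h n *\<^sub>R u) \<le> norm u" using h[of n] by (simp add: dist_norm mult_left_le_one_le)
    with False have "x + h n *\<^sub>R u \<notin> cball x0 e" "x \<notin> cball x0 e"
      using dist_triangle2[of x0 x "x + h n *\<^sub>R u"] norm_ge_zero[of u] unfolding mem_cball by linarith+
    with False supp show ?thesis by (simp add: q_def w_def)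
  qed
  have wint: "integrable lborel w" unfolding w_def
    by (intro integrable_mult_left) (simp add: integrable_indicator_iff emeasure_lborel_cball_finite[unfolded infinity_ennreal_def])
  have meas: "(\<lambda>x. f' x u) \<in> borel_measurable lborel"
    using borel_measurable_continuous_onI[OF cont] by simp
  have qmeas: "q n \<in> borel_measurable lborel" for n
    unfolding q_def using shift(1) fint by (auto intro!: borel_measurable_integrable)
  have limAE: "AE x in lborel. (\<lambda>n. q n x) \<longlonglongrightarrow> f' x u"
    and domAE: "AE x in lborel. norm (q n x) \<le> w x" for n using lim dom by auto
  show "integrable lborel (\<lambda>x. f' x u)"
    by (rule integrable_dominated_convergence[OF meas qmeas wint limAE domAE])
  have "(\<lambda>n. LINT x|lborel. q n x) \<longlonglongrightarrow> (LINT x|lborel. f' x u)"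
    by (rule integral_dominated_convergence[OF meas qmeas wint limAE domAE])
  then show "(LINT x|lborel. f' x u) = 0"
    by (simp add: q0 LIMSEQ_const_iff)
qed

lemma C2_gradient_hessian:
  fixes v :: "'a::euclidean_space \<Rightarrow> real"
  assumes S: "open S" and v: "Ck_on 2 v S"
  shows "\<exists>H. (\<forall>x\<in>S. (v has_derivative (\<lambda>k. grad v x \<bullet> k)) (at x) \<and> (grad v has_derivative H x) (at x))
    \<and> (\<forall>u. continuous_on S (\<lambda>x. H x u))"
proof -
  define D where "D i x = frechet_derivative v (at x) i" for i x
  define DD where "DD i x = frechet_derivative (D i) (at x)" for i x
  define H where "H x u = (\<Sum>i\<in>Basis. DD i x u *\<^sub>R i)" for x u
  have v1: "(v has_derivative frechet_derivative v (at x)) (at x)" if "x \<in> S" for x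
    using v that by (simp add: numeral_2_eq_2 frechet_derivative_works)
  have D: "(D i has_derivative DD i x) (at x)" if "x \<in> S" "i \<in> Basis" for i x
    using v that unfolding D_def DD_def by (simp add: numeral_2_eq_2 frechet_derivative_works)
  have DDc: "continuous_on S (\<lambda>x. DD i x j)" if "i \<in> Basis" "j \<in> Basis" for i j
    using v that unfolding D_def DD_def by (simp add: numeral_2_eq_2)
  have vD: "(v has_derivative (\<lambda>k. (\<Sum>i\<in>Basis. D i x *\<^sub>R i) \<bullet> k)) (at x)" if "x \<in> S" for x
  proof -
    have "frechet_derivative v (at x) = (\<lambda>k. (\<Sum>i\<in>Basis. D i x *\<^sub>R i) \<bullet> k)"
      unfolding D_def by (rule ext, rule linear_functional_eq_inner[OF has_derivative_linear[OF v1[OF that]]])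
    with v1[OF that] show ?thesis by simp
  qed
  then have grad: "grad v x = (\<Sum>i\<in>Basis. D i x *\<^sub>R i)" if "x \<in> S" for x
    using that by (intro grad_eqI)
  have "(grad v has_derivative H x) (at x)" if x: "x \<in> S" for x
  proof -
    have "((\<lambda>x. \<Sum>i\<in>Basis. D i x *\<^sub>R i) has_derivative H x) (at x)"
      unfolding H_def[abs_def] using D[OF x] by (auto intro!: has_derivative_sum has_derivative_scaleR_left)
    then show ?thesis
      by (rule has_derivative_transform_within_open[OF _ S x]) (simp add: grad)
  qed
  moreover have "continuous_on S (\<lambda>x. H x u)" for u
  proof -
    have "continuous_on S (\<lambda>x. \<Sum>i\<in>Basis. ((\<Sum>j\<in>Basis. DD i x j *\<^sub>R j) \<bullet> u) *\<^sub>R i)"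
      by (intro continuous_intros DDc) auto
    moreover have "H x u = (\<Sum>i\<in>Basis. ((\<Sum>j\<in>Basis. DD i x j *\<^sub>R j) \<bullet> u) *\<^sub>R i)" if "x \<in> S" for x
      unfolding H_def
      by (intro sum.cong refl arg_cong2[where f=scaleR] linear_functional_eq_inner
          has_derivative_linear[OF D[OF that]])
    ultimately show ?thesis by (rule continuous_on_eq[OF _ sym])
  qed
  ultimately show ?thesis using vD grad by (intro exI[of _ H]) simp
qed

lemma has_derivative_norm_powr_scaleR:
  fixes g :: "'a::euclidean_space \<Rightarrow> 'a"
  assumes g: "(g has_derivative H) (at x)" and "g x \<noteq> 0"
  shows "((\<lambda>x. (norm (g x) powr a) *\<^sub>R g x) has_derivative
    (\<lambda>u. (norm (g x) powr a) *\<^sub>R (H u + (a * (H u \<bullet> g x) / (norm (g x))\<^sup>2) *\<^sub>R g x))) (at x)"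
proof -
  have eq: "norm z powr a = (z \<bullet> z) powr (a / 2)" for z :: 'a
    by (cases "z = 0") (simp_all add: norm_eq_sqrt_inner powr_half_sqrt[symmetric] powr_powr)
  have pos: "g x \<bullet> g x > 0" using assms by simp
  have "((\<lambda>x. g x \<bullet> g x) has_derivative (\<lambda>u. 2 * (H u \<bullet> g x))) (at x)"
    using g by (auto intro!: derivative_eq_intros simp: inner_commute)
  from has_derivative_compose[OF this has_real_derivative_powr[OF pos, of "a/2", unfolded has_field_derivative_def]]
  have "((\<lambda>x. (g x \<bullet> g x) powr (a / 2)) has_derivative
      (\<lambda>u. a / 2 * (g x \<bullet> g x) powr (a / 2 - 1) * (2 * (H u \<bullet> g x)))) (at x)" .
  moreover have "a / 2 * (g x \<bullet> g x) powr (a / 2 - 1) * (2 * (H u \<bullet> g x))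
      = norm (g x) powr a * (a * (H u \<bullet> g x) / (norm (g x))\<^sup>2)" for u
    using pos by (simp add: eq powr_diff power2_norm_eq_inner)
  ultimately have "((\<lambda>x. norm (g x) powr a) has_derivative
      (\<lambda>u. norm (g x) powr a * (a * (H u \<bullet> g x) / (norm (g x))\<^sup>2))) (at x)"
    by (simp add: eq)
  from has_derivative_scaleR[OF this g] show ?thesis
    by (rule has_derivative_eq_rhs) (auto simp: algebra_simps)
qed

lemma sum_inner_Basis_linear:
  fixes L :: "'a::euclidean_space \<Rightarrow> 'a"
  assumes "linear L"
  shows "(\<Sum>i\<in>Basis. (L i \<bullet> w) * (z \<bullet> i)) = L z \<bullet> w"
proof -
  have "L z \<bullet> w = L (\<Sum>i\<in>Basis. (z \<bullet> i) *\<^sub>R i) \<bullet> w" by (simp add: euclidean_representation)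
  also have "\<dots> = (\<Sum>i\<in>Basis. (L i \<bullet> w) * (z \<bullet> i))"
    using assms by (simp add: linear_sum linear_cmul inner_sum_left mult.commute)
  finally show ?thesis by simp
qed

text \<open>Near a point where \<open>\<nabla>v \<noteq> 0\<close> the field \<open>|\<nabla>v|\<^bsup>p-2\<^esup> \<nabla>v\<close> is \<open>C\<^sup>1\<close>, so the weak equation
  can be integrated by parts and holds pointwise.\<close>

lemma weak_solution_pointwise:
  fixes v :: "'a::euclidean_space \<Rightarrow> real"
  assumes \<Omega>: "open \<Omega>" and x0: "x0 \<in> \<Omega>" "grad v x0 \<noteq> 0"
    and pos: "\<And>x. x \<in> \<Omega> \<Longrightarrow> v x > 0"
    and v: "\<And>x. x \<in> \<Omega> \<Longrightarrow> (v has_derivative (\<lambda>k. grad v x \<bullet> k)) (at x)"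
    and H: "\<And>x. x \<in> \<Omega> \<Longrightarrow> (grad v has_derivative H x) (at x)"
    and Hc: "\<And>u. continuous_on \<Omega> (\<lambda>x. H x u)"
    and weak: "weak_solution p b c q r \<Omega> v"
  shows "norm (grad v x0) powr (p - 2) *
      ((\<Sum>i\<in>Basis. H x0 i \<bullet> i) + (p - 2) * (H x0 (grad v x0) \<bullet> grad v x0) / (norm (grad v x0))\<^sup>2)
    + b * norm (grad v x0) powr q + c * v x0 powr r = 0"
proof -
  let ?g = "grad v"
  define U where "U = {x \<in> \<Omega>. ?g x \<noteq> 0}"
  have gc: "continuous_on \<Omega> ?g"
    using H by (auto intro!: continuous_at_imp_continuous_on intro: has_derivative_continuous)
  have vc: "continuous_on \<Omega> v"
    using v by (auto intro!: continuous_at_imp_continuous_on intro: has_derivative_continuous)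
  have "open (\<Omega> \<inter> ?g -` (- {0}))"
    by (rule continuous_open_preimage[OF gc \<Omega>]) auto
  then have U: "open U" "U \<subseteq> \<Omega>" "x0 \<in> U" "\<And>x. x \<in> U \<Longrightarrow> ?g x \<noteq> 0"
    using x0 unfolding U_def by (auto simp: vimage_def Int_def)
  define X where "X x = (norm (?g x) powr (p - 2)) *\<^sub>R ?g x" for x
  define DX where "DX x u = (norm (?g x) powr (p - 2)) *\<^sub>R
    (H x u + ((p - 2) * (H x u \<bullet> ?g x) / (norm (?g x))\<^sup>2) *\<^sub>R ?g x)" for x u
  have X: "(X has_derivative DX x) (at x)" if "x \<in> U" for x
    using has_derivative_norm_powr_scaleR[OF H[of x], of "p - 2"] U that
    unfolding X_def DX_def by auto
  define E where "E x = (\<Sum>i\<in>Basis. DX x i \<bullet> i) + b * norm (?g x) powr q + c * v x powr r" for x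
  have cg: "continuous_on U ?g" "continuous_on U v" "\<And>u. continuous_on U (\<lambda>x. H x u)"
    using gc vc Hc U(2) continuous_on_subset by blast+
  have DXc: "continuous_on U (\<lambda>x. DX x u)" for u
    unfolding DX_def by (intro continuous_intros cg) (use U in auto)
  have ne: "?g x \<noteq> 0" "v x \<noteq> 0" if "x \<in> U" for x
    using U that pos[of x] by auto
  have Ec: "continuous_on U E"
    unfolding E_def by (intro continuous_intros cg DXc) (auto simp: ne)
  have "E x0 = 0"
  proof (rule ccontr)
    assume E0: "E x0 \<noteq> 0"
    define \<sigma> where "\<sigma> = sgn (E x0)"
    have "open (U \<inter> (\<lambda>x. \<sigma> * E x) -` {0<..})"
      by (rule continuous_open_preimage[OF _ U(1)]) (auto intro!: continuous_intros Ec)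
    moreover have "x0 \<in> U \<inter> (\<lambda>x. \<sigma> * E x) -` {0<..}"
      using E0 U(3) by (simp add: \<sigma>_def sgn_if)
    ultimately obtain e where e: "e > 0" and sub: "cball x0 e \<subseteq> U \<inter> (\<lambda>x. \<sigma> * E x) -` {0<..}"
      using open_contains_cball by blast
    have eU: "cball x0 e \<subseteq> U" and e\<Omega>: "cball x0 e \<subseteq> \<Omega>" using sub U(2) by auto
    define \<psi> where "\<psi> = bump x0 e"
    obtain D where D: "\<And>x. (\<psi> has_derivative (\<lambda>k. D x \<bullet> k)) (at x)" and Dc: "continuous_on UNIV D"
      using bump_C1[of x0 e] unfolding \<psi>_def by blast
    have \<psi>0: "\<psi> x = 0" if "x \<notin> cball x0 e" for x
      using that e unfolding \<psi>_def by (intro bump_eq_0) auto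
    have D0: "D x = 0" if "x \<notin> cball x0 e" for x
    proof -
      have "((\<lambda>x. 0) has_derivative (\<lambda>k. 0)) (at x)" by simp
      then have "(\<psi> has_derivative (\<lambda>k. 0)) (at x)"
        by (rule has_derivative_transform_within_open[OF _ open_Compl[OF closed_cball[of x0 e]]])
          (use that \<psi>0 in auto)
      with D[of x] have "(\<lambda>k. D x \<bullet> k) = (\<lambda>k. 0)" by (metis has_derivative_unique)
      then have "D x \<bullet> D x = 0" by metis
      then show ?thesis by simp
    qed
    have \<psi>c: "continuous_on UNIV \<psi>"
      using D by (auto intro!: continuous_at_imp_continuous_on intro: has_derivative_continuous)
    have grad\<psi>: "grad \<psi> x = D x" for x using D by (rule grad_eqI)
    define F where "F i x u = (if x \<in> cball x0 e then D x \<bullet> u * (X x \<bullet> i) + \<psi> x * (DX x u \<bullet> i) else 0)" for i x u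
    have FU: "F i x u = D x \<bullet> u * (X x \<bullet> i) + \<psi> x * (DX x u \<bullet> i)" for i x u
      using \<psi>0 D0 by (auto simp: F_def)
    have Fder: "((\<lambda>x. \<psi> x * (X x \<bullet> i)) has_derivative F i x) (at x)" for i x
    proof (cases "x \<in> U")
      case True
      show ?thesis unfolding FU
        by (rule has_derivative_eq_rhs[OF has_derivative_mult[OF D has_derivative_inner_left[OF X[OF True]]]])
          (auto simp: algebra_simps)
    next
      case False
      then have x: "x \<notin> cball x0 e" using eU by blast
      have "F i x = (\<lambda>u. 0)" using x by (auto simp: F_def)
      then have "((\<lambda>x. 0) has_derivative F i x) (at x)" by simp
      then show ?thesis
        by (rule has_derivative_transform_within_open[OF _ open_Compl[OF closed_cball[of x0 e]]])
          (use x \<psi>0 in auto)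
    qed
    have Fcont: "continuous_on UNIV (\<lambda>x. F i x u)" for i u
    proof -
      have Xc: "continuous_on U X"
        using X U(1) by (auto intro!: continuous_at_imp_continuous_on intro: has_derivative_continuous)
      have "continuous_on U (\<lambda>x. F i x u)" unfolding FU
        by (intro continuous_intros Xc DXc continuous_on_subset[OF Dc] continuous_on_subset[OF \<psi>c]) auto
      moreover have "continuous_on (- cball x0 e) (\<lambda>x. F i x u)"
        by (rule continuous_on_eq[OF continuous_on_const[of _ 0]]) (simp add: F_def)
      ultimately have "continuous_on (U \<union> - cball x0 e) (\<lambda>x. F i x u)"
        using U(1) by (intro continuous_on_open_Un) auto
      moreover have "U \<union> - cball x0 e = UNIV" using eU by blast
      ultimately show ?thesis by simp
    qed
    have Fint: "integrable lborel (\<lambda>x. F i x u)" "(LINT x|lborel. F i x u) = 0" for i u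
      using integral_derivative_compact_support[OF Fder Fcont, of x0 e] \<psi>0 by auto
    define Z where "Z x = (\<Sum>i\<in>Basis. F i x i)" for x
    have Z: "integrable lborel Z" "(LINT x|lborel. Z x) = 0"
      unfolding Z_def by (auto simp: Fint integral_sum)
    have Zeq: "Z x = D x \<bullet> X x + \<psi> x * (\<Sum>i\<in>Basis. DX x i \<bullet> i)" for x
      unfolding Z_def FU by (simp add: sum.distrib sum_distrib_left euclidean_inner[of "D x" "X x"])
    define I1 where "I1 x = indicator \<Omega> x *\<^sub>R (rpow (norm (?g x)) (p - 2) * (?g x \<bullet> grad \<psi> x))" for x
    define I2 where "I2 x = indicator \<Omega> x *\<^sub>R (b * (rpow (norm (?g x)) q * \<psi> x))" for x
    define I3 where "I3 x = indicator \<Omega> x *\<^sub>R (c * (rpow (v x) r * \<psi> x))" for x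
    have "\<psi> \<in> test_functions \<Omega>" unfolding \<psi>_def by (rule bump_test_function[OF e e\<Omega>])
    with weak have I: "integrable lborel I1" "integrable lborel I2" "integrable lborel I3"
      and Ieq: "- (LINT x|lborel. I1 x) + (LINT x|lborel. I2 x) + (LINT x|lborel. I3 x) = 0"
      unfolding weak_solution_def set_integrable_def set_lebesgue_integral_def I1_def I2_def I3_def
      by (auto simp flip: integral_mult_right_zero simp: algebra_simps)
    have rp: "rpow t a = t powr a" if "t > 0" for t a using that by (simp add: rpow_def)
    \<comment> \<open>\<open>Z\<close> is the divergence of \<open>\<psi> X\<close>: with its vanishing integral, the weak equation says that
      \<open>\<psi> E\<close> has integral zero, although \<open>\<psi> E\<close> has a strict sign on the ball.\<close>
    have sumeq: "Z x - I1 x + I2 x + I3 x = \<psi> x * E x" for x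
    proof (cases "x \<in> cball x0 e")
      case True
      then have "x \<in> \<Omega>" "?g x \<noteq> 0" "v x > 0" using e\<Omega> eU U(4) pos by auto
      then show ?thesis
        by (simp add: Zeq I1_def I2_def I3_def E_def rp X_def grad\<psi> algebra_simps inner_commute)
    next
      case False
      then show ?thesis by (simp add: Zeq I1_def I2_def I3_def grad\<psi> \<psi>0 D0)
    qed
    define W where "W x = \<sigma> * (\<psi> x * E x)" for x
    have Wint: "integrable lborel W" "(LINT x|lborel. W x) = 0"
      unfolding W_def sumeq[symmetric] using Z I Ieq by auto
    have W0: "0 \<le> W x" for x
    proof (cases "x \<in> cball x0 e")
      case True
      then have "0 < \<sigma> * E x" using sub by auto
      then show ?thesis using bump_nonneg[of x0 e x] by (simp add: W_def \<psi>_def mult.left_commute[of \<sigma>])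
    qed (simp add: W_def \<psi>0)
    have AEW: "AE x in lborel. W x = 0"
      using Wint integral_nonneg_eq_0_iff_AE[OF Wint(1)] W0 by auto
    have Wball: "W x \<noteq> 0" if "x \<in> ball x0 e" for x
    proof -
      have "x \<in> cball x0 e" using that by auto
      then have "0 < \<sigma> * E x" using sub by auto
      moreover have "0 < \<psi> x" unfolding \<psi>_def using that bump_pos_iff[OF e] by blast
      ultimately show ?thesis by (auto simp: W_def)
    qed
    have "AE x in lborel. x \<notin> ball x0 e"
      using AEW by (rule eventually_mono) (use Wball in blast)
    then have "emeasure lborel (ball x0 e) = 0"
      by (subst (asm) AE_iff_measurable[OF _ refl]) (auto simp del: mem_ball)
    then have "measure lborel (ball x0 e) = 0" by (simp add: measure_def)
    with content_ball_pos[OF e, of x0] show False by simp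
  qed
  moreover have "(\<Sum>i\<in>Basis. DX x0 i \<bullet> i) = norm (?g x0) powr (p - 2) *
      ((\<Sum>i\<in>Basis. H x0 i \<bullet> i) + (p - 2) * (H x0 (?g x0) \<bullet> ?g x0) / (norm (?g x0))\<^sup>2)"
  proof -
    have "(\<Sum>i\<in>Basis. DX x0 i \<bullet> i) = norm (?g x0) powr (p - 2) * ((\<Sum>i\<in>Basis. H x0 i \<bullet> i)
        + (p - 2) / (norm (?g x0))\<^sup>2 * (\<Sum>i\<in>Basis. (H x0 i \<bullet> ?g x0) * (?g x0 \<bullet> i)))"
      unfolding DX_def
      by (simp add: inner_left_distrib sum.distrib sum_distrib_left sum_distrib_right algebra_simps)
    then show ?thesis
      using sum_inner_Basis_linear[OF has_derivative_linear[OF H[OF x0(1)]], of "?g x0" "?g x0"] by simp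
  qed
  ultimately show ?thesis unfolding E_def by simp
qed

section \<open>Maximum principle for the squared gradient\<close>

lemma strict_difference_quotient_vector:
  fixes f :: "'a::euclidean_space \<Rightarrow> 'b::euclidean_space"
  assumes "open S" "y \<in> S"
    and der: "\<And>z. z \<in> S \<Longrightarrow> (f has_derivative f' z) (at z)"
    and cont: "continuous_on S (\<lambda>z. f' z u)"
    and X: "X \<longlonglongrightarrow> y" and h: "h \<longlonglongrightarrow> 0" and h0: "\<And>n. h n \<noteq> 0"
  shows "(\<lambda>n. (f (X n + h n *\<^sub>R u) - f (X n)) /\<^sub>R h n) \<longlonglongrightarrow> f' y u"
proof (subst tendsto_componentwise_iff, intro ballI)
  fix i :: 'b assume "i \<in> Basis"
  have "(\<lambda>n. (f (X n + h n *\<^sub>R u) \<bullet> i - f (X n) \<bullet> i) / h n) \<longlonglongrightarrow> f' y u \<bullet> i"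
    by (rule strict_difference_quotient[OF assms(1,2) has_derivative_inner_left[OF der] _ X h h0])
      (auto intro!: continuous_intros cont)
  then show "(\<lambda>n. ((f (X n + h n *\<^sub>R u) - f (X n)) /\<^sub>R h n) \<bullet> i) \<longlonglongrightarrow> f' y u \<bullet> i"
    by (simp add: inner_diff_left divide_inverse mult.commute)
qed

text \<open>Continuity of \<open>H z u\<close> in \<open>z\<close> for each fixed \<open>u\<close> gives joint continuity, by linearity in \<open>u\<close>
  and finite dimension.\<close>

lemma linear_family_tendsto:
  fixes H :: "'a::euclidean_space \<Rightarrow> 'a \<Rightarrow> 'b::real_normed_vector"
  assumes "open S" "y \<in> S"
    and lin: "\<And>z. z \<in> S \<Longrightarrow> linear (H z)"
    and cont: "\<And>u. continuous_on S (\<lambda>z. H z u)"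
    and Z: "Z \<longlonglongrightarrow> y" and U: "U \<longlonglongrightarrow> u"
  shows "(\<lambda>n. H (Z n) (U n)) \<longlonglongrightarrow> H y u"
proof -
  have eq: "H z v = (\<Sum>i\<in>Basis. (v \<bullet> i) *\<^sub>R H z i)" if "z \<in> S" for z v
  proof -
    have "H z v = H z (\<Sum>i\<in>Basis. (v \<bullet> i) *\<^sub>R i)" by (simp add: euclidean_representation)
    then show ?thesis using lin[OF that] by (simp add: linear_sum linear_cmul)
  qed
  have "isCont (\<lambda>z. H z i) y" for i
    using cont assms(1,2) continuous_on_eq_continuous_at by blast
  then have "(\<lambda>n. \<Sum>i\<in>Basis. (U n \<bullet> i) *\<^sub>R H (Z n) i) \<longlonglongrightarrow> (\<Sum>i\<in>Basis. (u \<bullet> i) *\<^sub>R H y i)"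
    by (intro tendsto_intros U isCont_tendsto_compose[OF _ Z])
  then have "(\<lambda>n. \<Sum>i\<in>Basis. (U n \<bullet> i) *\<^sub>R H (Z n) i) \<longlonglongrightarrow> H y u"
    using eq[OF assms(2), of u] by simp
  moreover have "\<forall>\<^sub>F n in sequentially. (\<Sum>i\<in>Basis. (U n \<bullet> i) *\<^sub>R H (Z n) i) = H (Z n) (U n)"
    using topological_tendstoD[OF Z assms(1,2)] by (rule eventually_mono) (rule eq[symmetric])
  ultimately show ?thesis by (rule Lim_transform_eventually)
qed

lemma hessian_nonpos_at_local_max:
  fixes f :: "'a::euclidean_space \<Rightarrow> real"
  assumes S: "open S" "x \<in> S"
    and f: "\<And>z. z \<in> S \<Longrightarrow> (f has_derivative (\<lambda>k. g z \<bullet> k)) (at z)"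
    and g: "(g has_derivative L) (at x)"
    and max: "\<And>z. z \<in> S \<Longrightarrow> f z \<le> f x"
  shows "g x = 0" "L \<xi> \<bullet> \<xi> \<le> 0"
proof -
  have *: "g x \<bullet> \<xi> = 0 \<and> L \<xi> \<bullet> \<xi> \<le> 0" for \<xi>
  proof -
    obtain e where e: "e > 0" "ball x e \<subseteq> S" using S open_contains_ball by blast
    define d where "d = e / (1 + norm \<xi>)"
    have d: "d > 0" using e by (simp add: d_def add_pos_nonneg)
    have in_S: "x + t *\<^sub>R \<xi> \<in> S" if "\<bar>t\<bar> < d" for t
    proof -
      have "\<bar>t\<bar> * norm \<xi> \<le> \<bar>t\<bar> * (1 + norm \<xi>)" by (simp add: algebra_simps)
      also have "\<dots> < e" using that by (simp add: d_def pos_less_divide_eq add_pos_nonneg)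
      finally show ?thesis using e(2) by (auto simp: dist_norm)
    qed
    have line: "((\<lambda>t. x + t *\<^sub>R \<xi>) has_derivative (\<lambda>s. s *\<^sub>R \<xi>)) (at t)" for t
      by (auto intro!: derivative_eq_intros)
    have f1: "((\<lambda>t. f (x + t *\<^sub>R \<xi>)) has_real_derivative g (x + t *\<^sub>R \<xi>) \<bullet> \<xi>) (at t)" if "\<bar>t\<bar> < d" for t
      using has_derivative_compose[OF line f[OF in_S[OF that]]]
      by (simp add: has_field_derivative_def mult_commute_abs)
    have g': "(g has_derivative L) (at (x + 0 *\<^sub>R \<xi>))" using g by simp
    have f2: "((\<lambda>t. g (x + t *\<^sub>R \<xi>) \<bullet> \<xi>) has_real_derivative L \<xi> \<bullet> \<xi>) (at 0)"
      using has_derivative_inner_left[OF has_derivative_compose[OF line g'], of \<xi>] has_derivative_linear[OF g]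
      by (simp add: has_field_derivative_def mult_commute_abs linear_cmul)
    have max': "f (x + t *\<^sub>R \<xi>) \<le> f (x + 0 *\<^sub>R \<xi>)" if "\<bar>t\<bar> < d" for t
      using max in_S[OF that] by simp
    from second_derivative_nonpos_at_max[OF d max' f1 f2] show ?thesis by simp
  qed
  from *[of "g x"] show "g x = 0" by simp
  from * show "L \<xi> \<bullet> \<xi> \<le> 0" by simp
qed

text \<open>For a unit vector \<open>\<nu>\<close>, the symmetric square root of \<open>I + (p - 2) \<nu> \<nu>\<^sup>T\<close>. With
  \<open>\<nu> = \<nabla>w/|\<nabla>w|\<close> the latter is the coefficient matrix of the \<open>p\<close>-Laplacian divided by
  \<open>|\<nabla>w|\<^bsup>p-2\<^esup>\<close>.\<close>
definition sqrt_coeff :: "real \<Rightarrow> 'a::euclidean_space \<Rightarrow> 'a \<Rightarrow> 'a" where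
  "sqrt_coeff p \<nu> u = u + ((sqrt (p - 1) - 1) * (\<nu> \<bullet> u)) *\<^sub>R \<nu>"

lemma trace_sqrt_coeff:
  fixes L :: "'a::euclidean_space \<Rightarrow> 'a"
  assumes L: "linear L" and \<nu>: "norm \<nu> = 1" and p: "p > 1"
  shows "(\<Sum>i\<in>Basis. L (sqrt_coeff p \<nu> i) \<bullet> sqrt_coeff p \<nu> i) = (\<Sum>i\<in>Basis. L i \<bullet> i) + (p - 2) * (L \<nu> \<bullet> \<nu>)"
proof -
  define k where "k = sqrt (p - 1) - 1"
  have kk: "2 * k + k\<^sup>2 = p - 2" using p by (simp add: k_def power2_diff)
  have expand: "L (sqrt_coeff p \<nu> i) \<bullet> sqrt_coeff p \<nu> i = L i \<bullet> i + k * ((L i \<bullet> \<nu>) * (\<nu> \<bullet> i))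
     + k * ((\<nu> \<bullet> i) * (L \<nu> \<bullet> i)) + (k\<^sup>2 * (L \<nu> \<bullet> \<nu>)) * ((\<nu> \<bullet> i) * (\<nu> \<bullet> i))" for i
    using L by (simp add: sqrt_coeff_def linear_add linear_cmul inner_add_left inner_add_right
        power2_eq_square algebra_simps flip: k_def)
  have "(\<Sum>i\<in>Basis. (\<nu> \<bullet> i) * (\<nu> \<bullet> i)) = 1"
    using \<nu> euclidean_inner[of \<nu> \<nu>] by (simp add: norm_eq_1)
  moreover have "(\<Sum>i\<in>Basis. (\<nu> \<bullet> i) * (L \<nu> \<bullet> i)) = L \<nu> \<bullet> \<nu>"
    by (metis euclidean_inner inner_commute)
  ultimately have "(\<Sum>i\<in>Basis. L (sqrt_coeff p \<nu> i) \<bullet> sqrt_coeff p \<nu> i)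
      = (\<Sum>i\<in>Basis. L i \<bullet> i) + (2 * k + k\<^sup>2) * (L \<nu> \<bullet> \<nu>)"
    unfolding expand sum.distrib sum_distrib_left[symmetric] sum_inner_Basis_linear[OF L]
    by (simp add: algebra_simps)
  then show ?thesis by (simp only: kk)
qed

text \<open>The differentiated equation for \<open>|\<nabla>w|\<^sup>2\<close> in the viscosity sense, for \<open>w\<close> of class \<open>C\<^sup>2\<close>.
  If \<open>\<phi>\<close> touches \<open>|g|\<^sup>2\<close> from above at \<open>y\<close>, then the second conclusion bounds the expression which,
  for smooth \<open>w\<close>, is one half of \<open>\<Sum> a\<^sub>k\<^sub>l \<partial>\<^sub>k \<partial>\<^sub>l |\<nabla>w|\<^sup>2\<close> with the third derivatives of \<open>w\<close> eliminated
  by the equation; here \<open>a = I + (p - 2) \<nu> \<nu>\<^sup>T\<close>.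

  The proof replaces \<open>|\<nabla>w|\<^sup>2\<close> by the sum \<open>P\<close> of the squared difference quotients of \<open>w\<close>, which is
  twice differentiable even though \<open>w\<close> has only two derivatives. The difference \<open>P - \<phi> - |x - y|\<^sup>4\<close> attains
  maxima that converge to \<open>y\<close>, and at such a maximum the difference quotients of the Hessian
  are removed by subtracting the equation at two neighbouring points.\<close>

lemma gradient_square_touching:
  fixes w :: "'a::euclidean_space \<Rightarrow> real" and g :: "'a \<Rightarrow> 'a"
  assumes S: "open S" "y \<in> S" and p: "p > 1"
    and w: "\<And>x. x \<in> S \<Longrightarrow> (w has_derivative (\<lambda>k. g x \<bullet> k)) (at x)"
    and g: "\<And>x. x \<in> S \<Longrightarrow> (g has_derivative H x) (at x)"
    and Hc: "\<And>u. continuous_on S (\<lambda>x. H x u)"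
    and g0: "\<And>x. x \<in> S \<Longrightarrow> g x \<noteq> 0"
    and eq: "\<And>x. x \<in> S \<Longrightarrow>
      (\<Sum>i\<in>Basis. H x i \<bullet> i) + (p - 2) * (H x (g x) \<bullet> g x) / (norm (g x))\<^sup>2 = R x"
    and R: "\<And>x. x \<in> S \<Longrightarrow> (R has_derivative R' x) (at x)"
    and R'c: "\<And>u. continuous_on S (\<lambda>x. R' x u)"
    and \<phi>: "\<And>x. x \<in> S \<Longrightarrow> (\<phi> has_derivative (\<lambda>k. \<phi>' x \<bullet> k)) (at x)"
    and \<phi>': "\<And>x. x \<in> S \<Longrightarrow> (\<phi>' has_derivative \<phi>'' x) (at x)"
    and \<phi>'': "\<And>x u. x \<in> S \<Longrightarrow> \<phi>'' x u \<bullet> u \<le> \<kappa> x * (norm u)\<^sup>2"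
    and \<kappa>c: "continuous_on S \<kappa>"
    and touch: "\<And>x. x \<in> S \<Longrightarrow> (norm (g x))\<^sup>2 \<le> \<phi> x" "(norm (g y))\<^sup>2 = \<phi> y"
    and \<nu>: "\<nu> = g y /\<^sub>R norm (g y)"
  shows "2 *\<^sub>R H y (g y) = \<phi>' y"
    and "(\<Sum>i\<in>Basis. (norm (H y i))\<^sup>2) + (p - 2) * (norm (H y \<nu>))\<^sup>2 + R' y (g y)
      - 2 * (p - 2) * ((norm (H y \<nu>))\<^sup>2 - (H y \<nu> \<bullet> \<nu>)\<^sup>2) \<le> \<kappa> y * (real DIM('a) + p - 2) / 2"
proof -
  have lin: "linear (H x)" if "x \<in> S" for x using g[OF that] by (rule has_derivative_linear)
  have sym: "H x u \<bullet> v = u \<bullet> H x v" if "x \<in> S" for x u v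
    by (rule second_derivative_symmetric[OF S(1) that w g Hc])
  have gc: "continuous_on S g"
    using g by (auto intro!: continuous_at_imp_continuous_on intro: has_derivative_continuous)
  have \<phi>c: "continuous_on S \<phi>"
    using \<phi> by (auto intro!: continuous_at_imp_continuous_on intro: has_derivative_continuous)
  have \<phi>'c: "continuous_on S \<phi>'"
    using \<phi>' by (auto intro!: continuous_at_imp_continuous_on intro: has_derivative_continuous)
  \<comment> \<open>The direction of the gradient is written with an exponent so that the derivative formula for \<open>|g|\<^sup>a g\<close> applies.\<close>
  define N where "N x = (norm (g x) powr (- 1)) *\<^sub>R g x" for x
  define N' where "N' x u = (norm (g x) powr (- 1)) *\<^sub>R
      (H x u + (- 1 * (H x u \<bullet> g x) / (norm (g x))\<^sup>2) *\<^sub>R g x)" for x u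
  have N_eq: "N x = g x /\<^sub>R norm (g x)" if "x \<in> S" for x
    using g0[OF that] by (simp add: N_def powr_minus)
  have N1: "norm (N x) = 1" if "x \<in> S" for x
    using g0[OF that] by (simp add: N_eq[OF that])
  have N: "(N has_derivative N' x) (at x)" if "x \<in> S" for x
    using has_derivative_norm_powr_scaleR[OF g[OF that] g0[OF that], of "- 1"]
    unfolding N_def N'_def .
  have N'c: "continuous_on S (\<lambda>x. N' x u)" for u
    unfolding N'_def by (intro continuous_intros gc Hc) (auto simp: g0)
  have eqN: "(\<Sum>i\<in>Basis. H x i \<bullet> i) + (p - 2) * (H x (N x) \<bullet> N x) = R x" if "x \<in> S" for x
  proof -
    have "H x (N x) \<bullet> N x = (H x (g x) \<bullet> g x) / (norm (g x))\<^sup>2"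
      using lin[OF that] by (simp add: N_eq[OF that] linear_cmul power2_eq_square divide_inverse)
    with eq[OF that] show ?thesis by simp
  qed

  obtain r0 where r0: "r0 > 0" "cball y r0 \<subseteq> S" using S open_contains_cball by blast
  define r where "r = r0 / 2"
  have r: "r > 0" using r0 by (simp add: r_def)
  define h where "h n = r / real (Suc n)" for n
  have h: "h n > 0" "h n \<le> r" for n using r by (auto simp: h_def field_simps)
  have hlim: "h \<longlonglongrightarrow> 0"
    unfolding h_def using tendsto_mult_right_zero[OF LIMSEQ_inverse_real_of_nat, of r]
    by (simp add: divide_inverse)
  have KS: "x \<in> S" "x + h n *\<^sub>R i \<in> S" if "x \<in> cball y r" "i \<in> Basis" for x n i
  proof -
    have "dist y x \<le> r" using that by simp
    moreover have "dist x (x + h n *\<^sub>R i) \<le> r" using h[of n] that(2) by (simp add: dist_norm)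
    moreover have "2 * r = r0" by (simp add: r_def)
    ultimately have "dist y x \<le> r0" "dist y (x + h n *\<^sub>R i) \<le> r0"
      using dist_triangle[of y "x + h n *\<^sub>R i" x] r by linarith+
    then show "x \<in> S" "x + h n *\<^sub>R i \<in> S" using r0(2) by auto
  qed
  have KS0: "x \<in> S" if "x \<in> cball y r" for x
    using that r0 by (auto simp: r_def)
  define dw where "dw h i x = (w (x + h *\<^sub>R i) - w x) / h" for h :: real and i x
  define dg where "dg h i x = (g (x + h *\<^sub>R i) - g x) /\<^sub>R h" for h :: real and i x
  define dH where "dH h i x u = (H (x + h *\<^sub>R i) u - H x u) /\<^sub>R h" for h :: real and i x u
  define P where "P h x = (\<Sum>i\<in>Basis. (dw h i x)\<^sup>2)" for h x
  define \<Psi> where "\<Psi> h x = P h x - \<phi> x - ((x - y) \<bullet> (x - y))\<^sup>2" for h x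
  define \<Psi>' where "\<Psi>' h x = (\<Sum>i\<in>Basis. (2 * dw h i x) *\<^sub>R dg h i x) - \<phi>' x
      - (4 * ((x - y) \<bullet> (x - y))) *\<^sub>R (x - y)" for h x
  define \<Psi>'' where "\<Psi>'' h x u = (\<Sum>i\<in>Basis. (2 * (dg h i x \<bullet> u)) *\<^sub>R dg h i x + (2 * dw h i x) *\<^sub>R dH h i x u)
      - \<phi>'' x u - ((8 * ((x - y) \<bullet> u)) *\<^sub>R (x - y) + (4 * ((x - y) \<bullet> (x - y))) *\<^sub>R u)" for h x u
  have shift: "((\<lambda>x. x + a) has_derivative (\<lambda>k. k)) (at x)" for a x :: 'a
    by (auto intro!: derivative_eq_intros)
  have dw: "(dw (h n) i has_derivative (\<lambda>k. dg (h n) i x \<bullet> k)) (at x)" if "x \<in> cball y r" "i \<in> Basis" for x n i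
    unfolding dw_def dg_def
    using has_derivative_diff[OF has_derivative_compose[OF shift w[OF KS(2)[OF that]]] w[OF KS(1)[OF that]],
        THEN has_derivative_mult_right[where x="inverse (h n)"]]
    by (simp add: inner_diff_left divide_inverse mult.commute)
  have dg: "(dg (h n) i has_derivative dH (h n) i x) (at x)" if "x \<in> cball y r" "i \<in> Basis" for x n i
    unfolding dg_def dH_def[abs_def]
    using has_derivative_diff[OF has_derivative_compose[OF shift g[OF KS(2)[OF that]]] g[OF KS(1)[OF that]]]
    by (intro has_derivative_scaleR_right)
  have \<Psi>: "(\<Psi> (h n) has_derivative (\<lambda>k. \<Psi>' (h n) x \<bullet> k)) (at x)" if "x \<in> cball y r" for x n
    unfolding \<Psi>_def P_def
    by (rule has_derivative_eq_rhs, (rule has_derivative_diff has_derivative_sum has_derivative_power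
          dw[OF that] \<phi>[OF KS0[OF that]] has_derivative_inner shift has_derivative_const has_derivative_ident | assumption)+)
      (auto simp: \<Psi>'_def fun_eq_iff inner_diff_left inner_diff_right inner_sum_left inner_sum_right inner_commute algebra_simps)
  have \<Psi>': "(\<Psi>' (h n) has_derivative \<Psi>'' (h n) x) (at x)" if "x \<in> cball y r" for x n
    unfolding \<Psi>'_def
    by (rule has_derivative_eq_rhs, (rule has_derivative_diff has_derivative_sum has_derivative_scaleR has_derivative_mult_right
          dw[OF that] dg[OF that] \<phi>'[OF KS0[OF that]] has_derivative_inner has_derivative_const has_derivative_ident | assumption)+)
      (auto simp: \<Psi>''_def fun_eq_iff inner_diff_left inner_diff_right inner_commute algebra_simps)
  have \<Psi>cont: "continuous_on (cball y r) (\<Psi> (h n))" for n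
    by (intro continuous_at_imp_continuous_on ballI has_derivative_continuous[OF \<Psi>])
  have "\<exists>x\<in>cball y r. \<forall>z\<in>cball y r. \<Psi> (h n) z \<le> \<Psi> (h n) x" for n
    using r by (intro continuous_attains_sup \<Psi>cont) auto
  then obtain X0 where X0: "\<And>n. X0 n \<in> cball y r" "\<And>n z. z \<in> cball y r \<Longrightarrow> \<Psi> (h n) z \<le> \<Psi> (h n) (X0 n)"
    by metis
  obtain x1 s where x1: "x1 \<in> cball y r" and s: "strict_mono s" and X0lim: "(X0 \<circ> s) \<longlonglongrightarrow> x1"
    using compact_cball[of y r] X0(1) unfolding compact_def by meson
  define X where "X n = X0 (s n)" for n
  define t where "t n = h (s n)" for n
  have t: "t \<longlonglongrightarrow> 0" "\<And>n. t n \<noteq> 0" "\<And>n. t n > 0"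
    using LIMSEQ_subseq_LIMSEQ[OF hlim s] h(1) by (auto simp: t_def[abs_def] o_def less_imp_neq[symmetric])
  have X1: "X \<longlonglongrightarrow> x1" using X0lim by (simp add: X_def[abs_def] o_def)
  have sumsq: "(\<Sum>i\<in>Basis. (z \<bullet> i)\<^sup>2) = (norm z)\<^sup>2" for z :: 'a
    by (subst power2_norm_eq_inner, subst euclidean_inner) (simp add: power2_eq_square)
  have Plim: "(\<lambda>n. P (t n) (Y n)) \<longlonglongrightarrow> (norm (g x))\<^sup>2" if "Y \<longlonglongrightarrow> x" "x \<in> S" for Y x
  proof -
    have "(\<lambda>n. dw (t n) i (Y n)) \<longlonglongrightarrow> g x \<bullet> i" for i
      unfolding dw_def
      by (rule strict_difference_quotient[OF S(1) that(2) w _ that(1) t(1,2)])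
        (auto intro!: continuous_intros gc)
    then have "(\<lambda>n. P (t n) (Y n)) \<longlonglongrightarrow> (\<Sum>i\<in>Basis. (g x \<bullet> i)\<^sup>2)"
      unfolding P_def by (intro tendsto_intros)
    then show ?thesis by (simp add: sumsq)
  qed
  have x1S: "x1 \<in> S" using x1 KS0 by blast
  \<comment> \<open>The quartic term makes the touching strict without changing derivatives up to order two at \<open>y\<close>.\<close>
  have "x1 = y"
  proof -
    have "(\<lambda>n. P (t n) y - \<phi> y) \<longlonglongrightarrow> (norm (g y))\<^sup>2 - \<phi> y"
      by (intro tendsto_intros Plim S)
    moreover have "(\<lambda>n. \<Psi> (t n) (X n)) \<longlonglongrightarrow> (norm (g x1))\<^sup>2 - \<phi> x1 - ((x1 - y) \<bullet> (x1 - y))\<^sup>2"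
    proof -
      have "isCont \<phi> x1" using \<phi>c S(1) x1S continuous_on_eq_continuous_at by blast
      then show ?thesis
        unfolding \<Psi>_def by (intro tendsto_intros Plim X1 x1S isCont_tendsto_compose[of _ \<phi>])
    qed
    moreover have "P (t n) y - \<phi> y \<le> \<Psi> (t n) (X n)" for n
    proof -
      have "\<Psi> (t n) y \<le> \<Psi> (t n) (X n)"
        using X0(2)[of y "s n"] r by (simp add: X_def t_def)
      then show ?thesis by (simp add: \<Psi>_def)
    qed
    ultimately have "(norm (g y))\<^sup>2 - \<phi> y \<le> (norm (g x1))\<^sup>2 - \<phi> x1 - ((x1 - y) \<bullet> (x1 - y))\<^sup>2"
      by (intro LIMSEQ_le) auto
    then have "((x1 - y) \<bullet> (x1 - y))\<^sup>2 \<le> 0" using touch(1)[OF x1S] touch(2) by linarith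
    then show ?thesis by simp
  qed
  then have X: "X \<longlonglongrightarrow> y" using X1 by simp
  have near: "\<forall>\<^sub>F n in sequentially. X n \<in> ball y r"
    using topological_tendstoD[OF X open_ball] r by simp
  have max: "\<Psi>' (t n) (X n) = 0" "\<Psi>'' (t n) (X n) u \<bullet> u \<le> 0" if "X n \<in> ball y r" for n u
  proof -
    have sub: "z \<in> cball y r" if "z \<in> ball y r" for z using that by auto
    have m: "\<Psi> (h (s n)) z \<le> \<Psi> (h (s n)) (X n)" if "z \<in> ball y r" for z
      unfolding X_def by (rule X0(2)[OF sub[OF that]])
    show "\<Psi>' (t n) (X n) = 0" "\<Psi>'' (t n) (X n) u \<bullet> u \<le> 0"
      unfolding t_def
      using hessian_nonpos_at_local_max[OF open_ball that \<Psi>[OF sub] \<Psi>'[OF sub[OF that]] m] by blast+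
  qed
  have dwlim: "(\<lambda>n. dw (t n) i (X n)) \<longlonglongrightarrow> g y \<bullet> i" for i
    unfolding dw_def
    by (rule strict_difference_quotient[OF S w _ X t(1,2)]) (auto intro!: continuous_intros gc)
  have dglim: "(\<lambda>n. dg (t n) i (X n)) \<longlonglongrightarrow> H y i" for i
    unfolding dg_def by (rule strict_difference_quotient_vector[OF S g Hc X t(1,2)])
  have XX: "(\<lambda>n. X n - y) \<longlonglongrightarrow> 0" using X by (simp add: LIM_zero)
  have XX2: "(\<lambda>n. (X n - y) \<bullet> (X n - y)) \<longlonglongrightarrow> (0::'a) \<bullet> 0" by (rule tendsto_inner[OF XX XX])
  have Basis_sum: "(\<Sum>i\<in>Basis. (z \<bullet> i) *\<^sub>R L i) = L z" if "linear L" for z :: 'a and L :: "'a \<Rightarrow> 'b::real_vector"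
  proof -
    have "L z = L (\<Sum>i\<in>Basis. (z \<bullet> i) *\<^sub>R i)" by (simp add: euclidean_representation)
    then show ?thesis using that by (simp add: linear_sum linear_cmul)
  qed
  have iso: "isCont \<kappa> y" "isCont \<phi>' y" "isCont N y"
  proof -
    show "isCont \<kappa> y" using \<kappa>c S continuous_on_eq_continuous_at by blast
    show "isCont \<phi>' y" using \<phi>'c S continuous_on_eq_continuous_at by blast
    show "isCont N y" using N[OF S(2)] by (rule has_derivative_continuous)
  qed
  show "2 *\<^sub>R H y (g y) = \<phi>' y"
  proof -
    have "(\<lambda>n. \<Psi>' (t n) (X n)) \<longlonglongrightarrow> (\<Sum>i\<in>Basis. (2 * (g y \<bullet> i)) *\<^sub>R H y i) - \<phi>' y - (4 * ((0::'a) \<bullet> 0)) *\<^sub>R 0"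
      unfolding \<Psi>'_def by (intro tendsto_intros dwlim dglim XX2 XX isCont_tendsto_compose[OF iso(2) X])
    moreover have "\<forall>\<^sub>F n in sequentially. \<Psi>' (t n) (X n) = 0"
      using near by (rule eventually_mono) (rule max(1))
    ultimately have "(\<Sum>i\<in>Basis. (2 * (g y \<bullet> i)) *\<^sub>R H y i) - \<phi>' y = 0"
      using tendsto_eventually LIMSEQ_unique by fastforce
    moreover have "(\<Sum>i\<in>Basis. (2 * (g y \<bullet> i)) *\<^sub>R H y i) = 2 *\<^sub>R H y (g y)"
      using Basis_sum[OF lin[OF S(2)], of "g y"] by (simp flip: scaleR_scaleR scaleR_sum_right)
    ultimately show ?thesis by simp
  qed

  define dN where "dN h i x = (N (x + h *\<^sub>R i) - N x) /\<^sub>R h" for h :: real and i x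
  define dR where "dR h i x = (R (x + h *\<^sub>R i) - R x) / h" for h :: real and i x
  define Q where "Q h i x = (norm (dg h i x))\<^sup>2 + (p - 2) * (dg h i x \<bullet> N x)\<^sup>2 + dw h i x *
      (dR h i x - (p - 2) * (H (x + h *\<^sub>R i) (N (x + h *\<^sub>R i) + N x) \<bullet> dN h i x))" for h :: real and i x
  let ?n = "real DIM('a)"
  have Qle: "(\<Sum>i\<in>Basis. Q (t n) i (X n)) \<le> (\<kappa> (X n) + 12 * (norm (X n - y))\<^sup>2) * (?n + p - 2) / 2"
    if "X n \<in> ball y r" for n
  proof -
    define x where "x = X n"
    have xK: "x \<in> cball y r" using that by (simp add: x_def)
    define \<sigma> where "\<sigma> = sqrt_coeff p (N x)"
    note tr = trace_sqrt_coeff[OF _ N1[OF KS0[OF xK]] p, folded \<sigma>_def]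
    have tr_id: "(\<Sum>j\<in>Basis. (norm (\<sigma> j))\<^sup>2) = ?n + p - 2"
      using tr[of "\<lambda>u. u"] N1[OF KS0[OF xK]]
      by (simp add: power2_norm_eq_inner linear_id[unfolded id_def] norm_eq_1)
    have tr_dg: "(\<Sum>j\<in>Basis. (dg (t n) i x \<bullet> \<sigma> j)\<^sup>2) = (norm (dg (t n) i x))\<^sup>2 + (p - 2) * (dg (t n) i x \<bullet> N x)\<^sup>2" for i
    proof -
      have "linear (\<lambda>u. (dg (t n) i x \<bullet> u) *\<^sub>R dg (t n) i x)"
        by (intro linearI) (simp_all add: inner_add_right scaleR_add_left)
      from tr[OF this] show ?thesis by (simp add: power2_eq_square[symmetric] sumsq)
    qed
    \<comment> \<open>Only the Hessian at \<open>z\<close> occurs after the equations at \<open>z\<close> and \<open>x\<close> are subtracted; the change of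
      the coefficient matrix contributes the difference quotient \<open>dN\<close> of \<open>N\<close>.\<close>
    have tr_dH: "(\<Sum>j\<in>Basis. dH (t n) i x (\<sigma> j) \<bullet> \<sigma> j)
        = dR (t n) i x - (p - 2) * (H (x + t n *\<^sub>R i) (N (x + t n *\<^sub>R i) + N x) \<bullet> dN (t n) i x)"
      if i: "i \<in> Basis" for i
    proof -
      define z where "z = x + t n *\<^sub>R i"
      have zS: "z \<in> S" "x \<in> S" using KS[OF xK i] by (auto simp: z_def t_def)
      have dHe: "dH (t n) i x u \<bullet> v = (H z u \<bullet> v - H x u \<bullet> v) / t n" for u v
        unfolding dH_def z_def[symmetric] by (simp add: inner_diff_left divide_inverse mult.commute)
      have "linear (dH (t n) i x)" using dg[OF xK i] unfolding t_def by (rule has_derivative_linear)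
      then have "(\<Sum>j\<in>Basis. dH (t n) i x (\<sigma> j) \<bullet> \<sigma> j)
          = (\<Sum>j\<in>Basis. dH (t n) i x j \<bullet> j) + (p - 2) * (dH (t n) i x (N x) \<bullet> N x)"
        by (rule tr)
      also have "\<dots> = ((\<Sum>j\<in>Basis. H z j \<bullet> j) + (p - 2) * (H z (N x) \<bullet> N x)
          - ((\<Sum>j\<in>Basis. H x j \<bullet> j) + (p - 2) * (H x (N x) \<bullet> N x))) / t n"
        unfolding dHe sum_divide_distrib[symmetric] sum_subtractf
        by (simp add: add_divide_distrib diff_divide_distrib algebra_simps)
      also have "\<dots> = (R z - R x - (p - 2) * (H z (N z) \<bullet> N z - H z (N x) \<bullet> N x)) / t n"
        using eqN[OF zS(1)] eqN[OF zS(2)] by (simp add: algebra_simps)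
      also have "H z (N z) \<bullet> N z - H z (N x) \<bullet> N x = H z (N z + N x) \<bullet> (N z - N x)"
        using sym[OF zS(1), of "N x" "N z"] lin[OF zS(1)]
        by (simp add: linear_add inner_add_left inner_add_right inner_diff_left inner_diff_right inner_commute)
      finally show ?thesis
        unfolding dR_def dN_def z_def by (simp add: divide_inverse algebra_simps)
    qed
    have np: "0 \<ge> (\<Sum>j\<in>Basis. \<Psi>'' (t n) x (\<sigma> j) \<bullet> \<sigma> j)"
      using max(2)[OF that] by (intro sum_nonpos) (simp add: x_def)
    have "\<Psi>'' (t n) x u \<bullet> u \<ge> 2 * (\<Sum>i\<in>Basis. (dg (t n) i x \<bullet> u)\<^sup>2 + dw (t n) i x * (dH (t n) i x u \<bullet> u))
        - (\<kappa> x + 12 * (norm (x - y))\<^sup>2) * (norm u)\<^sup>2" for u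
    proof -
      have "((x - y) \<bullet> u)\<^sup>2 \<le> (norm (x - y))\<^sup>2 * (norm u)\<^sup>2"
        using Cauchy_Schwarz_ineq[of "x - y" u] by (simp add: power2_norm_eq_inner)
      moreover have "\<phi>'' x u \<bullet> u \<le> \<kappa> x * (norm u)\<^sup>2" by (rule \<phi>''[OF KS0[OF xK]])
      moreover have "\<Psi>'' (t n) x u \<bullet> u = 2 * (\<Sum>i\<in>Basis. (dg (t n) i x \<bullet> u)\<^sup>2 + dw (t n) i x * (dH (t n) i x u \<bullet> u))
          - \<phi>'' x u \<bullet> u - (8 * ((x - y) \<bullet> u)\<^sup>2 + 4 * ((norm (x - y))\<^sup>2 * (norm u)\<^sup>2))"
        unfolding \<Psi>''_def inner_diff_left inner_add_left inner_sum_left inner_scaleR_left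
        by (simp add: sum_distrib_left power2_eq_square power2_norm_eq_inner[unfolded power2_eq_square] algebra_simps)
      ultimately show ?thesis by (simp add: algebra_simps)
    qed
    then have "(\<Sum>j\<in>Basis. \<Psi>'' (t n) x (\<sigma> j) \<bullet> \<sigma> j) \<ge> (\<Sum>j\<in>Basis. 2 * (\<Sum>i\<in>Basis. (dg (t n) i x \<bullet> \<sigma> j)\<^sup>2
        + dw (t n) i x * (dH (t n) i x (\<sigma> j) \<bullet> \<sigma> j)) - (\<kappa> x + 12 * (norm (x - y))\<^sup>2) * (norm (\<sigma> j))\<^sup>2)"
      by (intro sum_mono) 
    also have "(\<Sum>j\<in>Basis. 2 * (\<Sum>i\<in>Basis. (dg (t n) i x \<bullet> \<sigma> j)\<^sup>2
        + dw (t n) i x * (dH (t n) i x (\<sigma> j) \<bullet> \<sigma> j)) - (\<kappa> x + 12 * (norm (x - y))\<^sup>2) * (norm (\<sigma> j))\<^sup>2)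
        = 2 * (\<Sum>i\<in>Basis. \<Sum>j\<in>Basis. (dg (t n) i x \<bullet> \<sigma> j)\<^sup>2 + dw (t n) i x * (dH (t n) i x (\<sigma> j) \<bullet> \<sigma> j))
          - (\<kappa> x + 12 * (norm (x - y))\<^sup>2) * (\<Sum>j\<in>Basis. (norm (\<sigma> j))\<^sup>2)"
      unfolding sum_subtractf sum_distrib_left[symmetric] by (subst sum.swap) (rule refl)
    also have "(\<Sum>i\<in>Basis. \<Sum>j\<in>Basis. (dg (t n) i x \<bullet> \<sigma> j)\<^sup>2 + dw (t n) i x * (dH (t n) i x (\<sigma> j) \<bullet> \<sigma> j))
        = (\<Sum>i\<in>Basis. Q (t n) i x)"
      unfolding sum.distrib sum_distrib_left[symmetric] tr_dg Q_def
      by (simp add: tr_dH)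
    finally have "2 * (\<Sum>i\<in>Basis. Q (t n) i x) - (\<kappa> x + 12 * (norm (x - y))\<^sup>2) * (?n + p - 2) \<le> 0"
      unfolding tr_id using np by (rule order_trans)
    then show ?thesis unfolding x_def by simp
  qed
  have shiftlim: "(\<lambda>n. X n + t n *\<^sub>R i) \<longlonglongrightarrow> y" for i
    using tendsto_add[OF X tendsto_scaleR[OF t(1) tendsto_const[of i]]] by simp
  have Nlim: "(\<lambda>n. N (X n)) \<longlonglongrightarrow> N y" "(\<lambda>n. N (X n + t n *\<^sub>R i)) \<longlonglongrightarrow> N y" for i
    using isCont_tendsto_compose[OF iso(3)] X shiftlim by blast+
  have HNlim: "(\<lambda>n. H (X n + t n *\<^sub>R i) (N (X n + t n *\<^sub>R i) + N (X n))) \<longlonglongrightarrow> H y (N y + N y)" for i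
    by (rule linear_family_tendsto[OF S lin Hc shiftlim tendsto_add[OF Nlim(2,1)]])
  have dRlim: "(\<lambda>n. dR (t n) i (X n)) \<longlonglongrightarrow> R' y i" for i
    unfolding dR_def by (rule strict_difference_quotient[OF S R R'c X t(1,2)])
  have dNlim: "(\<lambda>n. dN (t n) i (X n)) \<longlonglongrightarrow> N' y i" for i
    unfolding dN_def by (rule strict_difference_quotient_vector[OF S N N'c X t(1,2)])
  define Q0 where "Q0 i = (norm (H y i))\<^sup>2 + (p - 2) * (H y i \<bullet> N y)\<^sup>2 + (g y \<bullet> i) *
      (R' y i - (p - 2) * (H y (N y + N y) \<bullet> N' y i))" for i
  have "(\<lambda>n. \<Sum>i\<in>Basis. Q (t n) i (X n)) \<longlonglongrightarrow> (\<Sum>i\<in>Basis. Q0 i)"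
    unfolding Q_def Q0_def by (intro tendsto_intros dglim dwlim dRlim dNlim HNlim Nlim)
  moreover have "(\<lambda>n. (\<kappa> (X n) + 12 * (norm (X n - y))\<^sup>2) * (?n + p - 2) / 2) \<longlonglongrightarrow>
      (\<kappa> y + 12 * (norm (0::'a))\<^sup>2) * (?n + p - 2) / 2"
    by (intro tendsto_intros XX isCont_tendsto_compose[OF iso(1) X]) simp
  moreover have "\<forall>\<^sub>F n in sequentially.
      (\<Sum>i\<in>Basis. Q (t n) i (X n)) \<le> (\<kappa> (X n) + 12 * (norm (X n - y))\<^sup>2) * (?n + p - 2) / 2"
    using near by (rule eventually_mono) (rule Qle)
  ultimately have lim: "(\<Sum>i\<in>Basis. Q0 i) \<le> (\<kappa> y + 12 * (norm (0::'a))\<^sup>2) * (?n + p - 2) / 2"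
    by (intro tendsto_le[OF sequentially_bot])
  have N\<nu>: "N y = \<nu>" using N_eq[OF S(2)] \<nu> by simp
  have linH: "linear (H y)" by (rule lin[OF S(2)])
  have 1: "(\<Sum>i\<in>Basis. (H y i \<bullet> \<nu>)\<^sup>2) = (norm (H y \<nu>))\<^sup>2"
    using sym[OF S(2), of _ \<nu>] by (simp add: sumsq[symmetric] inner_commute)
  have 2: "(\<Sum>i\<in>Basis. (g y \<bullet> i) * R' y i) = R' y (g y)"
    using Basis_sum[OF has_derivative_linear[OF R[OF S(2)]], of "g y"] by simp
  have N'g: "N' y (g y) = H y \<nu> - (H y \<nu> \<bullet> \<nu>) *\<^sub>R \<nu>"
    using g0[OF S(2)] linH
    by (simp add: N'_def \<nu> linear_cmul powr_minus scaleR_diff_right power2_eq_square divide_inverse)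
  have 3: "(\<Sum>i\<in>Basis. (g y \<bullet> i) * (H y (\<nu> + \<nu>) \<bullet> N' y i)) = 2 * ((norm (H y \<nu>))\<^sup>2 - (H y \<nu> \<bullet> \<nu>)\<^sup>2)"
  proof -
    have "(\<Sum>i\<in>Basis. (g y \<bullet> i) * (H y (\<nu> + \<nu>) \<bullet> N' y i)) = H y (\<nu> + \<nu>) \<bullet> (\<Sum>i\<in>Basis. (g y \<bullet> i) *\<^sub>R N' y i)"
      by (simp add: inner_sum_right)
    also have "\<dots> = H y (\<nu> + \<nu>) \<bullet> N' y (g y)"
      by (simp only: Basis_sum[OF has_derivative_linear[OF N[OF S(2)]]])
    also have "\<dots> = 2 * ((norm (H y \<nu>))\<^sup>2 - (H y \<nu> \<bullet> \<nu>)\<^sup>2)"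
      using linH by (simp add: N'g linear_add inner_add_left inner_diff_right power2_norm_eq_inner
          power2_eq_square[of "H y \<nu> \<bullet> \<nu>"])
    finally show ?thesis .
  qed
  have "(\<Sum>i\<in>Basis. Q0 i) = (\<Sum>i\<in>Basis. (norm (H y i))\<^sup>2) + (p - 2) * (\<Sum>i\<in>Basis. (H y i \<bullet> \<nu>)\<^sup>2)
      + ((\<Sum>i\<in>Basis. (g y \<bullet> i) * R' y i) - (p - 2) * (\<Sum>i\<in>Basis. (g y \<bullet> i) * (H y (\<nu> + \<nu>) \<bullet> N' y i)))"
    unfolding Q0_def N\<nu> by (simp add: sum.distrib sum_subtractf sum_distrib_left algebra_simps)
  with lim show "(\<Sum>i\<in>Basis. (norm (H y i))\<^sup>2) + (p - 2) * (norm (H y \<nu>))\<^sup>2 + R' y (g y)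
      - 2 * (p - 2) * ((norm (H y \<nu>))\<^sup>2 - (H y \<nu> \<bullet> \<nu>)\<^sup>2) \<le> \<kappa> y * (real DIM('a) + p - 2) / 2"
    unfolding 1 2 3 by (simp add: algebra_simps)
qed

section \<open>Coercivity on the four regions\<close>

text \<open>The role of the four regions. With \<open>X = (p - 1) |\<nabla>w|\<^sup>2\<close> and the lower-order terms
  \<open>b \<beta>\<close>, \<open>c \<gamma>\<close> of the equation, the quadratic form on the right is the main part of the
  Bernstein inequality. On each region it is positive definite, since \<open>b c \<ge> 0\<close> gives
  \<open>(b \<beta> + c \<gamma>)\<^sup>2 \<ge> (b \<beta>)\<^sup>2 + (c \<gamma>)\<^sup>2\<close> and each cross term is either nonnegative or dominated.
  The constant depends neither on \<open>b\<close> and \<open>c\<close> nor on the region that contains them.\<close>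

lemma W_coercive:
  fixes n p q r :: real
  assumes n: "n > 1"
  shows "\<exists>\<delta>>0. \<forall>b c X \<beta> \<gamma>. b * c \<ge> 0 \<longrightarrow> (b, c, q, r) \<in> W1 n p \<union> W2 n p \<union> W3 n p \<union> W4 n p \<longrightarrow>
    X \<ge> 0 \<longrightarrow> \<beta> \<ge> 0 \<longrightarrow> \<gamma> \<ge> 0 \<longrightarrow>
    \<delta> * (X\<^sup>2 + (b * \<beta>)\<^sup>2 + (c * \<gamma>)\<^sup>2) \<le> X\<^sup>2 + (b * \<beta> + c * \<gamma>)\<^sup>2
      + (n - 1) * X * (b * \<beta> * ((n + 1) / (n - 1) - q / (p - 1)) + c * \<gamma> * ((n + 1) / (n - 1) - r / (p - 1)))"
proof -
  define s where "s = (n + 1) / (n - 1) - q / (p - 1)"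
  define t where "t = (n + 1) / (n - 1) - r / (p - 1)"
  define m where "m \<tau> = (n - 1) * \<tau> / 2" for \<tau>
  \<comment> \<open>If the smallness condition of a region fails for \<open>q\<close>, \<open>r\<close>, that region imposes no constraint; the
    value \<open>1\<close> keeps the minimum below positive.\<close>
  define \<delta>0 where "\<delta>0 \<tau> = (if m \<tau> < 1 then 1 - m \<tau> else 1)" for \<tau>
  define \<tau> where "\<tau> = sqrt (s\<^sup>2 + t\<^sup>2)"
  define \<delta> where "\<delta> = min 1 (min (\<delta>0 \<bar>s\<bar>) (min (\<delta>0 \<bar>t\<bar>) (\<delta>0 \<tau>)))"
  have "\<delta>0 \<tau> > 0" for \<tau> by (simp add: \<delta>0_def)
  then have "\<delta> > 0" by (simp add: \<delta>_def)
  have \<delta>_le: "\<delta> \<le> \<delta>0 \<bar>s\<bar>" "\<delta> \<le> \<delta>0 \<bar>t\<bar>" "\<delta> \<le> \<delta>0 \<tau>"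
    unfolding \<delta>_def by (simp_all add: min_le_iff_disj)
  have cross: "(1 - m \<tau>) * (X\<^sup>2 + Y\<^sup>2) \<le> X\<^sup>2 + Y\<^sup>2 + (n - 1) * (X * Z)"
    if "X \<ge> 0" "Y \<ge> 0" "\<bar>Z\<bar> \<le> Y * \<tau>" "\<tau> \<ge> 0" for X Y Z \<tau> :: real
  proof -
    have "X * Y \<le> (X\<^sup>2 + Y\<^sup>2) / 2" using sum_squares_bound[of X Y] by simp
    then have "X * Y * \<tau> \<le> (X\<^sup>2 + Y\<^sup>2) / 2 * \<tau>" using that(4) by (rule mult_right_mono)
    moreover have "X * \<bar>Z\<bar> \<le> X * (Y * \<tau>)" using that by (intro mult_left_mono)
    moreover have "- (X * \<bar>Z\<bar>) \<le> X * Z"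
      using that(1) mult_left_mono[of "- \<bar>Z\<bar>" Z X] by simp
    ultimately have "- ((X\<^sup>2 + Y\<^sup>2) / 2 * \<tau>) \<le> X * Z" by (simp add: mult.assoc)
    then have "(n - 1) * (- ((X\<^sup>2 + Y\<^sup>2) / 2 * \<tau>)) \<le> (n - 1) * (X * Z)" using n by (intro mult_left_mono) auto
    then show ?thesis by (simp add: m_def algebra_simps diff_divide_distrib add_divide_distrib)
  qed
  have "\<delta> * (X\<^sup>2 + (b * \<beta>)\<^sup>2 + (c * \<gamma>)\<^sup>2)
      \<le> X\<^sup>2 + (b * \<beta> + c * \<gamma>)\<^sup>2 + (n - 1) * X * (b * \<beta> * s + c * \<gamma> * t)"
    if bc: "b * c \<ge> 0" and W: "(b, c, q, r) \<in> W1 n p \<union> W2 n p \<union> W3 n p \<union> W4 n p"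
      and X: "X \<ge> 0" and \<beta>: "\<beta> \<ge> 0" and \<gamma>: "\<gamma> \<ge> 0" for b c X \<beta> \<gamma> :: real
  proof -
    define B D where "B = b * \<beta>" and "D = c * \<gamma>"
    have "B * D = (b * c) * (\<beta> * \<gamma>)" by (simp add: B_def D_def)
    then have BD: "B\<^sup>2 + D\<^sup>2 \<le> (B + D)\<^sup>2" using bc \<beta> \<gamma> by (simp add: power2_sum)
    have sq0: "X\<^sup>2 \<ge> 0" "B\<^sup>2 \<ge> 0" "D\<^sup>2 \<ge> 0" by auto
    have Bs: "0 \<le> (n - 1) * (X * (B * s))" if "b * s \<ge> 0"
    proof -
      have *: "B * s = (b * s) * \<beta>" by (simp add: B_def)
      have pos: "0 \<le> B * s" unfolding * using that \<beta> by (rule mult_nonneg_nonneg)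
      show ?thesis
        by (rule mult_nonneg_nonneg[OF _ mult_nonneg_nonneg[OF X pos]]) (use n in simp)
    qed
    have Dt: "0 \<le> (n - 1) * (X * (D * t))" if "c * t \<ge> 0"
    proof -
      have *: "D * t = (c * t) * \<gamma>" by (simp add: D_def)
      have pos: "0 \<le> D * t" unfolding * using that \<gamma> by (rule mult_nonneg_nonneg)
      show ?thesis
        by (rule mult_nonneg_nonneg[OF _ mult_nonneg_nonneg[OF X pos]]) (use n in simp)
    qed
    have mlt: "m \<bar>\<tau>\<bar> < 1" if "\<bar>\<tau>\<bar> < 2 / (n - 1)" for \<tau>
      using that n by (simp add: m_def pos_less_divide_eq mult.commute)
    have scale: "\<delta> * Z \<le> e * Z" if "\<delta> \<le> e" "Z \<ge> 0" for e Z using that by (rule mult_right_mono)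
    have key: "\<delta> * (X\<^sup>2 + B\<^sup>2 + D\<^sup>2) \<le> X\<^sup>2 + B\<^sup>2 + D\<^sup>2 + (n - 1) * (X * (B * s)) + (n - 1) * (X * (D * t))"
    proof -
      have d1: "\<delta> \<le> 1" by (simp add: \<delta>_def)
      consider "b * s \<ge> 0" "c * t \<ge> 0" | "b * s \<ge> 0" "\<bar>t\<bar> < 2 / (n - 1)"
        | "\<bar>s\<bar> < 2 / (n - 1)" "c * t \<ge> 0" | "s\<^sup>2 + t\<^sup>2 < 4 / (n - 1)\<^sup>2"
        using W by (auto simp: W1_def W2_def W3_def W4_def s_def t_def)
      then show ?thesis
      proof cases
        case 1
        have "0 \<le> X\<^sup>2 + B\<^sup>2 + D\<^sup>2" using sq0 by simp
        have trivial: "a \<le> 1 * z \<Longrightarrow> 0 \<le> u \<Longrightarrow> 0 \<le> v \<Longrightarrow> a \<le> z + u + v" for a z u v :: real by linarith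
        show ?thesis by (rule trivial[OF scale[OF d1 \<open>0 \<le> X\<^sup>2 + B\<^sup>2 + D\<^sup>2\<close>] Bs[OF 1(1)] Dt[OF 1(2)]])
      next
        case 2
        have "\<delta> \<le> 1 - m \<bar>t\<bar>" using \<delta>_le(2) mlt[OF 2(2)] by (simp add: \<delta>0_def)
        from scale[OF this, of "X\<^sup>2 + D\<^sup>2"] cross[of X "\<bar>D\<bar>" "D * t" "\<bar>t\<bar>"] X
        have "\<delta> * (X\<^sup>2 + D\<^sup>2) \<le> X\<^sup>2 + D\<^sup>2 + (n - 1) * (X * (D * t))" by (simp add: abs_mult)
        with Bs[OF 2(1)] scale[OF d1 sq0(2)] show ?thesis by (simp add: algebra_simps)
      next
        case 3
        have "\<delta> \<le> 1 - m \<bar>s\<bar>" using \<delta>_le(1) mlt[OF 3(1)] by (simp add: \<delta>0_def)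
        from scale[OF this, of "X\<^sup>2 + B\<^sup>2"] cross[of X "\<bar>B\<bar>" "B * s" "\<bar>s\<bar>"] X
        have "\<delta> * (X\<^sup>2 + B\<^sup>2) \<le> X\<^sup>2 + B\<^sup>2 + (n - 1) * (X * (B * s))" by (simp add: abs_mult)
        with Dt[OF 3(2)] scale[OF d1 sq0(3)] show ?thesis by (simp add: algebra_simps)
      next
        case 4
        have "\<tau>\<^sup>2 < (2 / (n - 1))\<^sup>2" using 4 by (simp add: \<tau>_def power_divide)
        then have "\<tau> < 2 / (n - 1)" using n by (intro power2_less_imp_less[of \<tau>]) auto
        moreover have \<tau>: "\<tau> \<ge> 0" by (simp add: \<tau>_def)
        ultimately have "m \<tau> < 1" using mlt[of \<tau>] by simp
        then have "\<delta> \<le> 1 - m \<tau>" using \<delta>_le(3) by (simp add: \<delta>0_def)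
        define Y where "Y = sqrt (B\<^sup>2 + D\<^sup>2)"
        have Y: "Y \<ge> 0" "Y\<^sup>2 = B\<^sup>2 + D\<^sup>2" by (auto simp: Y_def)
        have "(B * s + D * t)\<^sup>2 \<le> (Y * \<tau>)\<^sup>2"
        proof -
          have "(Y * \<tau>)\<^sup>2 = (B\<^sup>2 + D\<^sup>2) * (s\<^sup>2 + t\<^sup>2)" by (simp add: power_mult_distrib Y \<tau>_def)
          also have "\<dots> = (B * s + D * t)\<^sup>2 + (B * t - D * s)\<^sup>2"
            by (simp add: power2_eq_square algebra_simps)
          finally show ?thesis by simp
        qed
        then have "\<bar>B * s + D * t\<bar>\<^sup>2 \<le> (Y * \<tau>)\<^sup>2" by simp
        then have "\<bar>B * s + D * t\<bar> \<le> Y * \<tau>"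
          using mult_nonneg_nonneg[OF Y(1) \<tau>] by (rule power2_le_imp_le)
        from cross[OF X Y(1) this \<tau>] scale[OF \<open>\<delta> \<le> 1 - m \<tau>\<close>, of "X\<^sup>2 + Y\<^sup>2"] Y(2)
        show ?thesis using sq0 by (simp add: algebra_simps)
      qed
    qed
    with BD show ?thesis unfolding B_def[symmetric] D_def[symmetric] by (simp add: algebra_simps)
  qed
  with \<open>\<delta> > 0\<close> show ?thesis unfolding s_def t_def by blast
qed

lemma scaled_young_inequality: "L * k * x \<le> e * x\<^sup>2 + L\<^sup>2 / (4 * e) * k\<^sup>2" if "e > 0" for L k x e :: real
proof -
  have "0 \<le> (2 * e * x - L * k)\<^sup>2 / (4 * e)" using that by simp
  also have "\<dots> = e * x\<^sup>2 + L\<^sup>2 / (4 * e) * k\<^sup>2 - L * k * x"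
    using that by (simp add: power2_eq_square field_simps)
  finally show ?thesis by simp
qed

text \<open>The pointwise Bernstein inequality with constants \<open>\<epsilon>\<close> and \<open>K\<close>. Its right-hand side is the
  expression bounded in \<open>gradient_square_touching\<close>, with \<open>F = |\<nabla>w|\<^sup>2\<close>, \<open>A = H \<nu> \<bullet> \<nu>\<close>, \<open>k = |H \<nu>|\<close>, \<open>h\<close> the
  squared Hilbert-Schmidt norm of the Hessian, \<open>b \<beta>\<close> and \<open>c \<gamma>\<close> the lower-order terms of the
  equation, and the derivative along \<open>\<nabla>w\<close> of the terms without second derivatives written out.
  The premise on \<open>h\<close> is the bound of the Hessian below by its trace orthogonal to \<open>\<nu>\<close>.\<close>

definition bernstein_coercive :: "real \<Rightarrow> real \<Rightarrow> real \<Rightarrow> real \<Rightarrow> real \<Rightarrow> real \<Rightarrow> real \<Rightarrow> real \<Rightarrow> bool" where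
  "bernstein_coercive n p q r b c \<epsilon> K \<longleftrightarrow> (\<forall>\<beta> \<gamma> F k A h. \<beta> \<ge> 0 \<longrightarrow> \<gamma> \<ge> 0 \<longrightarrow> F \<ge> 0 \<longrightarrow> \<bar>A\<bar> \<le> k \<longrightarrow>
    ((p - 1) * F + b * \<beta> + c * \<gamma> + (p - 1) * A)\<^sup>2 / (n - 1) \<le> h \<longrightarrow>
    \<epsilon> * F\<^sup>2 - K * k\<^sup>2 \<le> h + (p - 2) * k\<^sup>2
      - (F * ((q - p + 1) * (b * \<beta>) + (r - p + 1) * (c * \<gamma>))
        + (2 * (p - 1) * F + (q - p + 2) * (b * \<beta>) + (2 - p) * (c * \<gamma>)) * A)
      - 2 * (p - 2) * (k\<^sup>2 - A\<^sup>2))"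

text \<open>The terms with a factor \<open>A\<close> or \<open>k\<close> come from the gradient of \<open>|\<nabla>w|\<^sup>2\<close>. They are absorbed
  into the quadratic form of \<open>W_coercive\<close>, at the price of \<open>K k\<^sup>2\<close>.\<close>

lemma bernstein_coercivity:
  fixes n p q r :: real
  assumes n: "n > 1" and p: "p > 1"
  shows "\<exists>\<epsilon>>0. \<exists>K\<ge>0. \<forall>b c. b * c \<ge> 0 \<longrightarrow>
    (b, c, q, r) \<in> W1 n p \<union> W2 n p \<union> W3 n p \<union> W4 n p \<longrightarrow> bernstein_coercive n p q r b c \<epsilon> K"
proof -
  from W_coercive[OF n, of q r p] obtain \<delta> where \<delta>: "\<delta> > 0" and
    coer: "\<And>b c X \<beta> \<gamma>. b * c \<ge> 0 \<Longrightarrow> (b, c, q, r) \<in> W1 n p \<union> W2 n p \<union> W3 n p \<union> W4 n p \<Longrightarrow>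
    X \<ge> 0 \<Longrightarrow> \<beta> \<ge> 0 \<Longrightarrow> \<gamma> \<ge> 0 \<Longrightarrow>
    \<delta> * (X\<^sup>2 + (b * \<beta>)\<^sup>2 + (c * \<gamma>)\<^sup>2) \<le> X\<^sup>2 + (b * \<beta> + c * \<gamma>)\<^sup>2
      + (n - 1) * X * (b * \<beta> * ((n + 1) / (n - 1) - q / (p - 1)) + c * \<gamma> * ((n + 1) / (n - 1) - r / (p - 1)))"
    by blast
  define e where "e = \<delta> / (2 * (n - 1))"
  define L where "L = 2 * (p - 1) / (n - 1) + 2 + \<bar>q - p + 2\<bar> + \<bar>2 - p\<bar>"
  define K where "K = 3 * (L\<^sup>2 / (4 * e)) + 3 * \<bar>p - 2\<bar>"
  have e: "e > 0" using \<delta> n by (simp add: e_def)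
  have L: "L \<ge> 0" "2 * (p - 1) / (n - 1) + 2 \<le> L" "2 * (p - 1) / (n - 1) + \<bar>q - p + 2\<bar> \<le> L"
    "2 * (p - 1) / (n - 1) + \<bar>2 - p\<bar> \<le> L" using n p by (auto simp: L_def)
  have K: "K \<ge> 0" using e by (simp add: K_def)
  have "e * (p - 1)\<^sup>2 * F\<^sup>2 - K * k\<^sup>2 \<le> h + (p - 2) * k\<^sup>2
      - (F * ((q - p + 1) * (b * \<beta>) + (r - p + 1) * (c * \<gamma>))
        + (2 * (p - 1) * F + (q - p + 2) * (b * \<beta>) + (2 - p) * (c * \<gamma>)) * A)
      - 2 * (p - 2) * (k\<^sup>2 - A\<^sup>2)"
    if bc: "b * c \<ge> 0" and W: "(b, c, q, r) \<in> W1 n p \<union> W2 n p \<union> W3 n p \<union> W4 n p"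
      and nonneg: "\<beta> \<ge> 0" "\<gamma> \<ge> 0" "F \<ge> 0" and A: "\<bar>A\<bar> \<le> k"
      and h: "((p - 1) * F + b * \<beta> + c * \<gamma> + (p - 1) * A)\<^sup>2 / (n - 1) \<le> h"
    for b c \<beta> \<gamma> F k A h :: real
  proof -
    define B D X where "B = b * \<beta>" and "D = c * \<gamma>" and "X = (p - 1) * F"
    define S where "S = X + B + D"
    have X0: "X \<ge> 0" using nonneg p by (simp add: X_def)
    have k0: "k \<ge> 0" using A by linarith
    have Ak: "A\<^sup>2 \<le> k\<^sup>2" using power_mono[OF A abs_ge_zero, of 2] by simp
    have main: "2 * e * (X\<^sup>2 + B\<^sup>2 + D\<^sup>2) \<le> S\<^sup>2 / (n - 1) - F * ((q - p + 1) * B + (r - p + 1) * D)"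
    proof -
      have "\<delta> * (X\<^sup>2 + B\<^sup>2 + D\<^sup>2) \<le> X\<^sup>2 + (B + D)\<^sup>2
        + (n - 1) * X * (B * ((n + 1) / (n - 1) - q / (p - 1)) + D * ((n + 1) / (n - 1) - r / (p - 1)))"
        unfolding B_def D_def by (rule coer[OF bc W X0 nonneg(1,2)])
      also have "(n - 1) * X * (B * ((n + 1) / (n - 1) - q / (p - 1)) + D * ((n + 1) / (n - 1) - r / (p - 1)))
        = 2 * X * (B + D) - (n - 1) * (F * ((q - p + 1) * B + (r - p + 1) * D))"
      proof -
        have split: "(n - 1) * X * (B * (\<mu> - \<theta>)) = X * B * ((n - 1) * \<mu>) - (n - 1) * F * B * ((p - 1) * \<theta>)"
          for B \<mu> \<theta> by (simp add: X_def algebra_simps)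
        have *: "(n - 1) * X * (B * ((n + 1) / (n - 1) - \<theta> / (p - 1))) = 2 * X * B - (n - 1) * (F * ((\<theta> - p + 1) * B))" for B \<theta>
        proof -
          have "(n - 1) * ((n + 1) / (n - 1)) = n + 1" "(p - 1) * (\<theta> / (p - 1)) = \<theta>" using n p by auto
          moreover have "(n - 1) * X * (B * ((n + 1) / (n - 1) - \<theta> / (p - 1)))
            = X * B * ((n - 1) * ((n + 1) / (n - 1))) - (n - 1) * F * B * ((p - 1) * (\<theta> / (p - 1)))"
            by (rule split)
          ultimately show ?thesis by (simp add: X_def algebra_simps)
        qed
        show ?thesis unfolding distrib_left[of "(n - 1) * X"] * by (simp add: algebra_simps)
      qed
      finally have "\<delta> * (X\<^sup>2 + B\<^sup>2 + D\<^sup>2) \<le> S\<^sup>2 - (n - 1) * (F * ((q - p + 1) * B + (r - p + 1) * D))"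
        by (simp add: S_def power2_eq_square algebra_simps)
      then have "\<delta> * (X\<^sup>2 + B\<^sup>2 + D\<^sup>2) / (n - 1) \<le> (S\<^sup>2 - (n - 1) * (F * ((q - p + 1) * B + (r - p + 1) * D))) / (n - 1)"
        using n by (intro divide_right_mono) auto
      also have "\<dots> = S\<^sup>2 / (n - 1) - F * ((q - p + 1) * B + (r - p + 1) * D)"
        using n by (simp add: diff_divide_distrib)
      also have "\<delta> * (X\<^sup>2 + B\<^sup>2 + D\<^sup>2) / (n - 1) = 2 * e * (X\<^sup>2 + B\<^sup>2 + D\<^sup>2)"
        using n by (simp add: e_def field_simps)
      finally show ?thesis .
    qed
    have bound: "M * Z * A \<le> M' * k * \<bar>Z\<bar>" if "\<bar>M\<bar> \<le> M'" for M M' Z :: real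
    proof -
      have "M * Z * A \<le> \<bar>M\<bar> * \<bar>Z\<bar> * \<bar>A\<bar>" by (metis abs_ge_self abs_mult)
      also have "\<dots> \<le> M' * \<bar>Z\<bar> * k" using that A by (intro mult_mono) auto
      finally show ?thesis by (simp add: mult_ac)
    qed
    define l where "l = 2 * (p - 1) / (n - 1)"
    have l0: "l \<ge> 0" using n p by (simp add: l_def)
    have expand: "(S + (p - 1) * A)\<^sup>2 / (n - 1) \<ge> S\<^sup>2 / (n - 1) + l * S * A"
    proof -
      have "(S + (p - 1) * A)\<^sup>2 = S\<^sup>2 + 2 * (p - 1) * S * A + ((p - 1) * A)\<^sup>2"
        by (simp add: power2_eq_square algebra_simps)
      then have "(S + (p - 1) * A)\<^sup>2 / (n - 1) = S\<^sup>2 / (n - 1) + l * S * A + ((p - 1) * A)\<^sup>2 / (n - 1)"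
        by (simp add: l_def add_divide_distrib)
      then show ?thesis using n by simp
    qed
    have errX: "- (l * X * A) + 2 * X * A \<le> e * X\<^sup>2 + L\<^sup>2 / (4 * e) * k\<^sup>2"
    proof -
      have "(2 - l) * X * A \<le> L * k * \<bar>X\<bar>" using L l0 by (intro bound) (auto simp: l_def)
      also have "\<dots> \<le> e * \<bar>X\<bar>\<^sup>2 + L\<^sup>2 / (4 * e) * k\<^sup>2" by (rule scaled_young_inequality[OF e])
      finally show ?thesis by (simp add: algebra_simps)
    qed
    have errB: "- (l * B * A) + (q - p + 2) * B * A \<le> e * B\<^sup>2 + L\<^sup>2 / (4 * e) * k\<^sup>2"
    proof -
      have "((q - p + 2) - l) * B * A \<le> L * k * \<bar>B\<bar>" using L l0 by (intro bound) (auto simp: l_def)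
      also have "\<dots> \<le> e * \<bar>B\<bar>\<^sup>2 + L\<^sup>2 / (4 * e) * k\<^sup>2" by (rule scaled_young_inequality[OF e])
      finally show ?thesis by (simp add: algebra_simps)
    qed
    have errD: "- (l * D * A) + (2 - p) * D * A \<le> e * D\<^sup>2 + L\<^sup>2 / (4 * e) * k\<^sup>2"
    proof -
      have "((2 - p) - l) * D * A \<le> L * k * \<bar>D\<bar>" using L l0 by (intro bound) (auto simp: l_def)
      also have "\<dots> \<le> e * \<bar>D\<bar>\<^sup>2 + L\<^sup>2 / (4 * e) * k\<^sup>2" by (rule scaled_young_inequality[OF e])
      finally show ?thesis by (simp add: algebra_simps)
    qed
    have errk: "2 * (p - 2) * (k\<^sup>2 - A\<^sup>2) - (p - 2) * k\<^sup>2 \<le> 3 * \<bar>p - 2\<bar> * k\<^sup>2"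
    proof -
      have "(p - 2) * (k\<^sup>2 - A\<^sup>2) \<le> \<bar>p - 2\<bar> * k\<^sup>2" using Ak by (intro mult_mono) auto
      moreover have "- (p - 2) * k\<^sup>2 \<le> \<bar>p - 2\<bar> * k\<^sup>2" by (intro mult_right_mono) auto
      ultimately show ?thesis by (simp add: algebra_simps)
    qed
    have "S * A = X * A + B * A + D * A" by (simp add: S_def algebra_simps)
    then have lS: "l * S * A = l * X * A + l * B * A + l * D * A" by (simp add: S_def algebra_simps)
    have eB: "0 \<le> e * B\<^sup>2" "0 \<le> e * D\<^sup>2" using e by auto
    have "e * X\<^sup>2 - K * k\<^sup>2 \<le> h + (p - 2) * k\<^sup>2 - (F * ((q - p + 1) * B + (r - p + 1) * D)
        + (2 * X * A + (q - p + 2) * B * A + (2 - p) * D * A)) - 2 * (p - 2) * (k\<^sup>2 - A\<^sup>2)"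
    proof -
      have h': "(S + (p - 1) * A)\<^sup>2 / (n - 1) \<le> h"
        using h unfolding S_def X_def B_def D_def .
      have m': "2 * (e * X\<^sup>2) + 2 * (e * B\<^sup>2) + 2 * (e * D\<^sup>2) \<le> S\<^sup>2 / (n - 1) - F * ((q - p + 1) * B + (r - p + 1) * D)"
        using main by (simp add: algebra_simps)
      have K': "K * k\<^sup>2 = 3 * (L\<^sup>2 / (4 * e) * k\<^sup>2) + 3 * \<bar>p - 2\<bar> * k\<^sup>2"
        unfolding K_def by (simp add: distrib_right mult.assoc)
      show ?thesis using h' m' K' expand errX errB errD errk lS eB by linarith
    qed
    moreover have "e * X\<^sup>2 = e * (p - 1)\<^sup>2 * F\<^sup>2" by (simp add: X_def power_mult_distrib)
    moreover have "2 * X * A + (q - p + 2) * B * A + (2 - p) * D * A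
        = (2 * (p - 1) * F + (q - p + 2) * B + (2 - p) * D) * A" by (simp add: X_def algebra_simps)
    ultimately show ?thesis unfolding B_def[symmetric] D_def[symmetric] by simp
  qed
  moreover have "e * (p - 1)\<^sup>2 > 0" using e p by simp
  ultimately show ?thesis using K unfolding bernstein_coercive_def by blast
qed

section \<open>Local gradient estimate\<close>

text \<open>Cauchy-Schwarz on the orthogonal complement of \<open>\<nu>\<close>, which has dimension \<open>n - 1\<close>. This refinement
  of the bound by the full trace is what produces the exponents in the four regions.\<close>

lemma hilbert_schmidt_lower_bound:
  fixes L :: "'a::euclidean_space \<Rightarrow> 'a"
  assumes L: "linear L" and \<nu>: "norm \<nu> = 1" and dim: "DIM('a) \<ge> 2"
  shows "((\<Sum>i\<in>Basis. L i \<bullet> i) - L \<nu> \<bullet> \<nu>)\<^sup>2 / (real DIM('a) - 1) \<le> (\<Sum>i\<in>Basis. (norm (L i))\<^sup>2)"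
proof -
  define P where "P i = i - (\<nu> \<bullet> i) *\<^sub>R \<nu>" for i
  have \<nu>\<nu>: "\<nu> \<bullet> \<nu> = 1" using \<nu> by (simp add: norm_eq_1)
  have sum1: "(\<Sum>i\<in>Basis. (\<nu> \<bullet> i) * (\<nu> \<bullet> i)) = 1"
    using euclidean_inner[of \<nu> \<nu>] \<nu>\<nu> by simp
  have tr: "(\<Sum>i\<in>Basis. L i \<bullet> P i) = (\<Sum>i\<in>Basis. L i \<bullet> i) - L \<nu> \<bullet> \<nu>"
  proof -
    have "(\<Sum>i\<in>Basis. L i \<bullet> P i) = (\<Sum>i\<in>Basis. L i \<bullet> i) - (\<Sum>i\<in>Basis. (L i \<bullet> \<nu>) * (\<nu> \<bullet> i))"
      by (simp add: P_def inner_diff_right sum_subtractf mult.commute)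
    then show ?thesis by (simp add: sum_inner_Basis_linear[OF L])
  qed
  have nP: "(\<Sum>i\<in>Basis. (norm (P i))\<^sup>2) = real DIM('a) - 1"
  proof -
    have "(norm (P i))\<^sup>2 = 1 - (\<nu> \<bullet> i) * (\<nu> \<bullet> i)" if "i \<in> Basis" for i
      using that \<nu>\<nu>
      by (simp add: P_def power2_norm_eq_inner inner_diff_left inner_diff_right inner_commute algebra_simps)
    then show ?thesis by (simp add: sum_subtractf sum1)
  qed
  have "(\<Sum>i\<in>Basis. L i \<bullet> P i)\<^sup>2 \<le> (\<Sum>i\<in>Basis. norm (L i) * norm (P i))\<^sup>2"
  proof -
    have "\<bar>\<Sum>i\<in>Basis. L i \<bullet> P i\<bar> \<le> (\<Sum>i\<in>Basis. \<bar>L i \<bullet> P i\<bar>)" by (rule sum_abs)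
    also have "\<dots> \<le> (\<Sum>i\<in>Basis. norm (L i) * norm (P i))"
      by (intro sum_mono Cauchy_Schwarz_ineq2)
    finally show ?thesis using power_mono[of "\<bar>\<Sum>i\<in>Basis. L i \<bullet> P i\<bar>" _ 2] by simp
  qed
  also have "\<dots> \<le> (\<Sum>i\<in>Basis. (norm (L i))\<^sup>2) * (\<Sum>i\<in>Basis. (norm (P i))\<^sup>2)"
    by (rule Cauchy_Schwarz_ineq_sum)
  finally have "((\<Sum>i\<in>Basis. L i \<bullet> i) - L \<nu> \<bullet> \<nu>)\<^sup>2 \<le> (\<Sum>i\<in>Basis. (norm (L i))\<^sup>2) * (real DIM('a) - 1)"
    unfolding tr nP .
  then show ?thesis using dim by (simp add: pos_divide_le_eq)
qed

text \<open>Bernstein's argument: with the cut-off \<open>e = 1 - |x - x0|\<^sup>2/\<rho>\<^sup>2\<close>, let \<open>M\<close> be the maximum of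
  \<open>e\<^sup>2 |g|\<^sup>2\<close> on the ball. Then \<open>\<phi> = M/e\<^sup>2\<close> touches \<open>|g|\<^sup>2\<close> from above at the maximum point, and the
  coercivity assumption bounds \<open>M\<close> by a multiple of \<open>1/\<rho>\<^sup>2\<close>.\<close>

lemma local_gradient_estimate:
  fixes w :: "'a::euclidean_space \<Rightarrow> real" and g :: "'a \<Rightarrow> 'a"
  assumes dim: "DIM('a) \<ge> 2" and p: "p > 1" and \<epsilon>: "\<epsilon> > 0" and K: "K \<ge> 0"
    and coer: "bernstein_coercive (real DIM('a)) p q r b c \<epsilon> K"
    and \<Omega>: "open \<Omega>" and \<rho>: "\<rho> > 0" and ball: "cball x0 \<rho> \<subseteq> \<Omega>"
    and w: "\<And>x. x \<in> \<Omega> \<Longrightarrow> (w has_derivative (\<lambda>k. g x \<bullet> k)) (at x)"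
    and g: "\<And>x. x \<in> \<Omega> \<Longrightarrow> (g has_derivative H x) (at x)"
    and Hc: "\<And>u. continuous_on \<Omega> (\<lambda>x. H x u)"
    and eq: "\<And>x. x \<in> \<Omega> \<Longrightarrow> g x \<noteq> 0 \<Longrightarrow>
      (\<Sum>i\<in>Basis. H x i \<bullet> i) + (p - 2) * (H x (g x) \<bullet> g x) / (norm (g x))\<^sup>2 + (p - 1) * (g x \<bullet> g x)
      + b * exp ((q - p + 1) * w x + (q - p + 2) / 2 * ln (g x \<bullet> g x))
      + c * exp ((r - p + 1) * w x + (2 - p) / 2 * ln (g x \<bullet> g x)) = 0"
  shows "(norm (g x0))\<^sup>2 \<le> (14 * (real DIM('a) + p - 2) + 4 * K) / \<epsilon> / \<rho>\<^sup>2"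
proof (cases "g x0 = 0")
  case True
  then show ?thesis using dim p \<epsilon> K by (intro zero_le_power2 order_trans[OF _ divide_nonneg_nonneg]) auto
next
  case g0: False
  let ?n = "real DIM('a)"
  have gc: "continuous_on \<Omega> g"
    using g by (auto intro!: continuous_at_imp_continuous_on intro: has_derivative_continuous)
  have wc: "continuous_on \<Omega> w"
    using w by (auto intro!: continuous_at_imp_continuous_on intro: has_derivative_continuous)
  define e where "e x = 1 - ((x - x0) \<bullet> (x - x0)) / \<rho>\<^sup>2" for x
  define G where "G x = (e x)\<^sup>2 * (g x \<bullet> g x)" for x
  have gcb: "continuous_on (cball x0 \<rho>) g" using gc ball continuous_on_subset by blast
  have "continuous_on (cball x0 \<rho>) G"
    unfolding G_def e_def by (intro continuous_intros gcb) (use \<rho> in auto)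
  then obtain y where y: "y \<in> cball x0 \<rho>" and ymax: "\<And>x. x \<in> cball x0 \<rho> \<Longrightarrow> G x \<le> G y"
    using continuous_attains_sup[of "cball x0 \<rho>" G] \<rho> by auto
  define M where "M = G y"
  have "G x0 = g x0 \<bullet> g x0" by (simp add: G_def e_def)
  then have M0: "g x0 \<bullet> g x0 \<le> M" using ymax[of x0] \<rho> by (simp add: M_def)
  then have Mpos: "M > 0" using g0 by (smt (verit) inner_gt_zero_iff)
  then have ey: "e y \<noteq> 0" and gy: "g y \<noteq> 0" by (auto simp: M_def G_def)
  have e_ball: "0 < e x \<longleftrightarrow> x \<in> ball x0 \<rho>" for x
  proof -
    have "0 < e x \<longleftrightarrow> (norm (x - x0))\<^sup>2 < \<rho>\<^sup>2"
      using \<rho> by (simp add: e_def pos_divide_less_eq power2_norm_eq_inner)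
    also have "\<dots> \<longleftrightarrow> norm (x - x0) < \<rho>"
      using \<rho> by (meson less_imp_le norm_ge_zero pos2 power2_less_imp_less power_strict_mono)
    finally show ?thesis by (simp add: dist_norm norm_minus_commute)
  qed
  have e1: "e x \<le> 1" for x by (simp add: e_def)
  have yball: "y \<in> ball x0 \<rho>"
  proof (rule ccontr)
    assume "y \<notin> ball x0 \<rho>"
    then have "norm (y - x0) = \<rho>" using y by (simp add: dist_norm norm_minus_commute)
    then have "e y = 0" using \<rho> by (simp add: e_def power2_norm_eq_inner[symmetric])
    with ey show False by simp
  qed
  define S where "S = ball x0 \<rho> \<inter> {x \<in> \<Omega>. g x \<noteq> 0}"
  have "open (\<Omega> \<inter> g -` (- {0}))"
    by (rule continuous_open_preimage[OF gc \<Omega>]) auto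
  moreover have "{x \<in> \<Omega>. g x \<noteq> 0} = \<Omega> \<inter> g -` (- {0})" by auto
  ultimately have So: "open S" unfolding S_def by (metis open_Int open_ball)
  have yS: "y \<in> S" using yball gy ball by (auto simp: S_def)
  have S: "x \<in> \<Omega>" "g x \<noteq> 0" "0 < e x" "x \<in> cball x0 \<rho>" "g x \<bullet> g x > 0" if "x \<in> S" for x
    using that e_ball[of x] by (auto simp: S_def)
  have cS: "continuous_on S g" "continuous_on S w" "\<And>u. continuous_on S (\<lambda>x. H x u)" "continuous_on S e"
  proof -
    have "S \<subseteq> \<Omega>" by (auto simp: S_def)
    then show "continuous_on S g" "continuous_on S w" "\<And>u. continuous_on S (\<lambda>x. H x u)"
      using gc wc Hc continuous_on_subset by blast+
    show "continuous_on S e" unfolding e_def using \<rho> by (intro continuous_intros) auto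
  qed
  define \<beta> where "\<beta> x = exp ((q - p + 1) * w x + (q - p + 2) / 2 * ln (g x \<bullet> g x))" for x
  define \<gamma> where "\<gamma> x = exp ((r - p + 1) * w x + (2 - p) / 2 * ln (g x \<bullet> g x))" for x
  define \<beta>' where "\<beta>' x u = \<beta> x * ((q - p + 1) * (g x \<bullet> u) + (q - p + 2) * (H x u \<bullet> g x) / (g x \<bullet> g x))" for x u
  define \<gamma>' where "\<gamma>' x u = \<gamma> x * ((r - p + 1) * (g x \<bullet> u) + (2 - p) * (H x u \<bullet> g x) / (g x \<bullet> g x))" for x u
  define R where "R x = - ((p - 1) * (g x \<bullet> g x) + b * \<beta> x + c * \<gamma> x)" for x
  define R' where "R' x u = - ((p - 1) * (2 * (H x u \<bullet> g x)) + b * \<beta>' x u + c * \<gamma>' x u)" for x u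
  have gg: "((\<lambda>x. g x \<bullet> g x) has_derivative (\<lambda>u. 2 * (H x u \<bullet> g x))) (at x)" if "x \<in> S" for x
    using g[OF S(1)[OF that]] by (auto intro!: derivative_eq_intros simp: inner_commute)
  have expd: "((\<lambda>x. exp (\<mu> * w x + \<theta> / 2 * ln (g x \<bullet> g x))) has_derivative
      (\<lambda>u. exp (\<mu> * w x + \<theta> / 2 * ln (g x \<bullet> g x)) * (\<mu> * (g x \<bullet> u) + \<theta> * (H x u \<bullet> g x) / (g x \<bullet> g x)))) (at x)"
    if "x \<in> S" for x \<mu> \<theta>
  proof -
    have "((\<lambda>x. \<mu> * w x + \<theta> / 2 * ln (g x \<bullet> g x)) has_derivative
        (\<lambda>u. \<mu> * (g x \<bullet> u) + \<theta> / 2 * (2 * (H x u \<bullet> g x) / (g x \<bullet> g x)))) (at x)"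
      using has_derivative_compose[OF gg[OF that] DERIV_ln_divide[OF S(5)[OF that], unfolded has_field_derivative_def]]
      by (intro has_derivative_add has_derivative_mult_right w[OF S(1)[OF that]]) simp
    from has_derivative_compose[OF this DERIV_exp[unfolded has_field_derivative_def]]
    show ?thesis by simp
  qed
  have R: "(R has_derivative R' x) (at x)" if "x \<in> S" for x
    unfolding R_def R'_def[abs_def] \<beta>'_def \<gamma>'_def \<beta>_def \<gamma>_def
    by (intro has_derivative_minus has_derivative_add has_derivative_mult_right gg[OF that] expd[OF that])
  have \<beta>\<gamma>c: "continuous_on S \<beta>" "continuous_on S \<gamma>"
    unfolding \<beta>_def \<gamma>_def by (intro continuous_intros cS; use S in force)+
  have R'c: "continuous_on S (\<lambda>x. R' x u)" for u
    unfolding R'_def \<beta>'_def \<gamma>'_def by (intro continuous_intros cS \<beta>\<gamma>c; use S in force)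
  have eqR: "(\<Sum>i\<in>Basis. H x i \<bullet> i) + (p - 2) * (H x (g x) \<bullet> g x) / (norm (g x))\<^sup>2 = R x" if "x \<in> S" for x
    using eq[OF S(1,2)[OF that]] unfolding R_def \<beta>_def \<gamma>_def by linarith

  define \<phi> where "\<phi> x = M * (1 / (e x)^2)" for x
  define \<phi>' where "\<phi>' x = (4 * M / \<rho>\<^sup>2 * (1 / (e x)^3)) *\<^sub>R (x - x0)" for x
  define \<phi>'' where "\<phi>'' x u = (4 * M / \<rho>\<^sup>2 * (6 / \<rho>\<^sup>2 * (1 / (e x)^4) * ((x - x0) \<bullet> u))) *\<^sub>R (x - x0)
      + (4 * M / \<rho>\<^sup>2 * (1 / (e x)^3)) *\<^sub>R u" for x u
  define \<kappa> where "\<kappa> x = 28 * M / \<rho>\<^sup>2 * (1 / (e x)^4)" for x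
  have e_der: "(e has_derivative (\<lambda>u. - (2 * ((x - x0) \<bullet> u) / \<rho>\<^sup>2))) (at x)" for x
    unfolding e_def using \<rho> by (auto intro!: derivative_eq_intros simp: inner_commute field_simps)
  have inv_der: "((\<lambda>x. 1 / e x ^ m) has_derivative (\<lambda>u. real m * (2 / \<rho>\<^sup>2) * (1 / e x ^ Suc m) * ((x - x0) \<bullet> u))) (at x)"
    if "x \<in> S" for x m
  proof -
    have "((\<lambda>t. 1 / t ^ m) has_real_derivative - real m * (1 / e x ^ Suc m)) (at (e x))"
    proof -
      consider "m = 0" | j where "m = Suc j" by (cases m) auto
      then show ?thesis
      proof cases
        case 2
        have "((\<lambda>t. inverse (t ^ m)) has_real_derivative - real m * (1 / e x ^ Suc m)) (at (e x))"
          by (rule DERIV_cong[OF DERIV_inverse_fun[OF DERIV_pow]])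
            (use S(3)[OF that] 2 in \<open>simp_all add: field_simps power2_eq_square\<close>)
        then show ?thesis by (simp add: inverse_eq_divide)
      qed simp
    qed
    from has_derivative_compose[OF e_der this[unfolded has_field_derivative_def]]
    show ?thesis by (rule has_derivative_eq_rhs) (simp add: fun_eq_iff divide_inverse mult_ac)
  qed
  have \<phi>: "(\<phi> has_derivative (\<lambda>u. \<phi>' x \<bullet> u)) (at x)" if "x \<in> S" for x
    unfolding \<phi>_def
    by (rule has_derivative_eq_rhs[OF has_derivative_mult_right[OF inv_der[OF that, of 2]]])
      (simp add: \<phi>'_def fun_eq_iff eval_nat_numeral)
  have \<phi>': "(\<phi>' has_derivative \<phi>'' x) (at x)" if "x \<in> S" for x
    unfolding \<phi>'_def
    by (rule has_derivative_eq_rhs[OF has_derivative_scaleR[OF has_derivative_mult_right[OF inv_der[OF that, of 3]]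
          has_derivative_diff[OF has_derivative_ident has_derivative_const]]])
      (simp add: \<phi>''_def fun_eq_iff eval_nat_numeral add.commute)
  have zball: "(norm (x - x0))\<^sup>2 \<le> \<rho>\<^sup>2" if "x \<in> S" for x
    using S(4)[OF that] by (intro power_mono) (auto simp: dist_norm norm_minus_commute)
  have \<phi>''b: "\<phi>'' x u \<bullet> u \<le> \<kappa> x * (norm u)\<^sup>2" if "x \<in> S" for x u
  proof -
    have ex: "0 < e x" "e x \<le> 1" using S(3)[OF that] e1 by auto
    have "((x - x0) \<bullet> u)\<^sup>2 \<le> (norm (x - x0))\<^sup>2 * (norm u)\<^sup>2"
      using Cauchy_Schwarz_ineq[of "x - x0" u] by (simp add: power2_norm_eq_inner)
    also have "\<dots> \<le> \<rho>\<^sup>2 * (norm u)\<^sup>2" using zball[OF that] by (intro mult_right_mono) auto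
    finally have "((x - x0) \<bullet> u)\<^sup>2 / \<rho>\<^sup>2 \<le> (norm u)\<^sup>2" using \<rho> by (simp add: pos_divide_le_eq mult.commute)
    then have "24 * M / \<rho>\<^sup>2 * (1 / (e x)^4) * (((x - x0) \<bullet> u)\<^sup>2 / \<rho>\<^sup>2) \<le> 24 * M / \<rho>\<^sup>2 * (1 / (e x)^4) * (norm u)\<^sup>2"
      using Mpos by (intro mult_left_mono) auto
    moreover have "1 / (e x)^3 \<le> 1 / (e x)^4"
      using ex by (intro divide_left_mono power_decreasing) auto
    then have "4 * M / \<rho>\<^sup>2 * (1 / (e x)^3) * (norm u)\<^sup>2 \<le> 4 * M / \<rho>\<^sup>2 * (1 / (e x)^4) * (norm u)\<^sup>2"
      using Mpos by (intro mult_right_mono mult_left_mono) auto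
    moreover have "\<phi>'' x u \<bullet> u = 24 * M / \<rho>\<^sup>2 * (1 / (e x)^4) * (((x - x0) \<bullet> u)\<^sup>2 / \<rho>\<^sup>2)
        + 4 * M / \<rho>\<^sup>2 * (1 / (e x)^3) * (norm u)\<^sup>2"
      unfolding \<phi>''_def by (simp add: inner_add_left power2_norm_eq_inner power2_eq_square[of "(x - x0) \<bullet> u"]
          power2_eq_square[of \<rho>] power4_eq_xxxx mult_ac)
    moreover have "\<kappa> x * (norm u)\<^sup>2 = 24 * M / \<rho>\<^sup>2 * (1 / (e x)^4) * (norm u)\<^sup>2
        + 4 * M / \<rho>\<^sup>2 * (1 / (e x)^4) * (norm u)\<^sup>2"
      unfolding \<kappa>_def using \<rho> ex by (simp add: field_simps)
    ultimately show ?thesis by linarith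
  qed
  have \<kappa>c: "continuous_on S \<kappa>"
    unfolding \<kappa>_def by (intro continuous_intros cS) (use S(3) in force)
  have touch: "(norm (g x))\<^sup>2 \<le> \<phi> x" if "x \<in> S" for x
    using ymax[OF S(4)[OF that]] S(3)[OF that]
    by (simp add: \<phi>_def M_def G_def power2_norm_eq_inner pos_le_divide_eq mult.commute)
  have touch_y: "(norm (g y))\<^sup>2 = \<phi> y"
    using ey by (simp add: \<phi>_def M_def G_def power2_norm_eq_inner)
  define \<nu> where "\<nu> = g y /\<^sub>R norm (g y)"
  have \<nu>1: "norm \<nu> = 1" using gy by (simp add: \<nu>_def)
  note bern = gradient_square_touching[OF So yS p w[OF S(1)] g[OF S(1)] cS(3) S(2) eqR R R'c \<phi> \<phi>' \<phi>''b \<kappa>c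
      touch touch_y \<nu>_def]
  define F where "F = (norm (g y))\<^sup>2"
  define k where "k = norm (H y \<nu>)"
  define A where "A = H y \<nu> \<bullet> \<nu>"
  define h where "h = (\<Sum>i\<in>Basis. (norm (H y i))\<^sup>2)"
  have y\<Omega>: "y \<in> \<Omega>" using S(1)[OF yS] .
  have lin: "linear (H y)" using g[OF y\<Omega>] by (rule has_derivative_linear)
  have F0: "F > 0" using gy by (simp add: F_def)
  have Hg: "H y (g y) \<bullet> g y = F * A"
    using gy lin by (simp add: F_def A_def \<nu>_def linear_cmul power2_eq_square field_simps)
  have Ak: "\<bar>A\<bar> \<le> k" using Cauchy_Schwarz_ineq2[of "H y \<nu>" \<nu>] \<nu>1 by (simp add: A_def k_def)
  have trace: "(\<Sum>i\<in>Basis. H y i \<bullet> i) - A = - ((p - 1) * F + b * \<beta> y + c * \<gamma> y + (p - 1) * A)"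
  proof -
    have "(p - 2) * (F * A) / F = (p - 2) * A" using F0 by simp
    with eqR[OF yS] have "(\<Sum>i\<in>Basis. H y i \<bullet> i) + (p - 2) * A = R y" unfolding Hg F_def[symmetric] by simp
    then show ?thesis
      by (simp add: R_def power2_norm_eq_inner[symmetric] F_def[symmetric] algebra_simps)
  qed
  have hle: "((p - 1) * F + b * \<beta> y + c * \<gamma> y + (p - 1) * A)\<^sup>2 / (?n - 1) \<le> h"
    using hilbert_schmidt_lower_bound[OF lin \<nu>1 dim] unfolding A_def[symmetric] trace h_def[symmetric] power2_minus .
  have R'g: "R' y (g y) = - (F * ((q - p + 1) * (b * \<beta> y) + (r - p + 1) * (c * \<gamma> y))
        + (2 * (p - 1) * F + (q - p + 2) * (b * \<beta> y) + (2 - p) * (c * \<gamma> y)) * A)"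
  proof -
    have "g y \<bullet> g y = F" by (simp add: F_def power2_norm_eq_inner)
    moreover have "\<theta> * (F * A) / F = \<theta> * A" for \<theta> using F0 by simp
    ultimately show ?thesis by (simp only: R'_def \<beta>'_def \<gamma>'_def Hg) (simp add: algebra_simps)
  qed
  have ineq: "\<epsilon> * F\<^sup>2 - K * k\<^sup>2 \<le> \<kappa> y * (?n + p - 2) / 2"
  proof -
    have "\<epsilon> * F\<^sup>2 - K * k\<^sup>2 \<le> h + (p - 2) * k\<^sup>2
      - (F * ((q - p + 1) * (b * \<beta> y) + (r - p + 1) * (c * \<gamma> y))
        + (2 * (p - 1) * F + (q - p + 2) * (b * \<beta> y) + (2 - p) * (c * \<gamma> y)) * A)
      - 2 * (p - 2) * (k\<^sup>2 - A\<^sup>2)"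
      using F0 by (intro coer[unfolded bernstein_coercive_def, rule_format, OF _ _ _ Ak hle]) (auto simp: \<beta>_def \<gamma>_def)
    also have "\<dots> = h + (p - 2) * k\<^sup>2 + R' y (g y) - 2 * (p - 2) * (k\<^sup>2 - A\<^sup>2)"
      unfolding R'g by simp
    also have "\<dots> \<le> \<kappa> y * (?n + p - 2) / 2"
      using bern(2) unfolding h_def k_def A_def .
    finally show ?thesis .
  qed
  have eypos: "0 < e y" using S(3)[OF yS] .
  have Feq: "F = M / (e y)\<^sup>2" using touch_y by (simp add: F_def \<phi>_def)
  \<comment> \<open>The first-order condition \<open>2 H g = \<nabla>\<phi>\<close> at \<open>y\<close> determines \<open>k\<close>.\<close>
  have k2: "k\<^sup>2 \<le> 4 * M / \<rho>\<^sup>2 / (e y)^4"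
  proof -
    have "2 * sqrt F * k = norm (2 *\<^sub>R H y (g y))"
      using gy lin by (simp add: k_def \<nu>_def linear_cmul F_def)
    also have "\<dots> = 4 * M / \<rho>\<^sup>2 / (e y)^3 * norm (y - x0)"
    proof -
      have "norm (\<phi>' y) = 4 * M / \<rho>\<^sup>2 / (e y)^3 * norm (y - x0)" using Mpos eypos by (simp add: \<phi>'_def)
      then show ?thesis using bern(1) by simp
    qed
    finally have "(2 * sqrt F * k)\<^sup>2 = (4 * M / \<rho>\<^sup>2 / (e y)^3 * norm (y - x0))\<^sup>2" by simp
    also have "\<dots> = (4 * M / \<rho>\<^sup>2 / (e y)^3)\<^sup>2 * (norm (y - x0))\<^sup>2" by (rule power_mult_distrib)
    also have "\<dots> \<le> (4 * M / \<rho>\<^sup>2 / (e y)^3)\<^sup>2 * \<rho>\<^sup>2"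
      using zball[OF yS] by (intro mult_left_mono) auto
    finally have "4 * F * k\<^sup>2 \<le> (4 * M / \<rho>\<^sup>2 / (e y)^3)\<^sup>2 * \<rho>\<^sup>2"
      using F0 by (simp add: power_mult_distrib)
    also have "\<dots> = 4 * F * (4 * M / \<rho>\<^sup>2 / (e y)^4)"
      unfolding Feq using \<rho> eypos by (simp add: field_simps power2_eq_square eval_nat_numeral)
    finally show ?thesis by (rule mult_left_le_imp_le) (use F0 in simp)
  qed
  have "\<epsilon> * F\<^sup>2 \<le> K * (4 * M / \<rho>\<^sup>2 / (e y)^4) + \<kappa> y * (?n + p - 2) / 2"
    using ineq mult_left_mono[OF k2 K] by linarith
  also have "\<dots> = M / (e y)^4 * ((14 * (?n + p - 2) + 4 * K) / \<rho>\<^sup>2)"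
    unfolding \<kappa>_def using \<rho> eypos by (simp add: field_simps)
  also have "\<epsilon> * F\<^sup>2 = M / (e y)^4 * (\<epsilon> * M)"
    unfolding Feq by (simp add: power_divide power2_eq_square eval_nat_numeral mult_ac)
  finally have "\<epsilon> * M \<le> (14 * (?n + p - 2) + 4 * K) / \<rho>\<^sup>2"
    by (rule mult_left_le_imp_le) (use Mpos eypos in simp)
  then have "M \<le> (14 * (?n + p - 2) + 4 * K) / \<rho>\<^sup>2 / \<epsilon>"
    unfolding pos_le_divide_eq[OF \<epsilon>] by (subst mult.commute)
  then have "g x0 \<bullet> g x0 \<le> (14 * (?n + p - 2) + 4 * K) / \<rho>\<^sup>2 / \<epsilon>" using M0 by linarith
  moreover have "(14 * (?n + p - 2) + 4 * K) / \<rho>\<^sup>2 / \<epsilon> = (14 * (?n + p - 2) + 4 * K) / \<epsilon> / \<rho>\<^sup>2"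
    by (simp only: divide_divide_eq_left mult.commute)
  ultimately show ?thesis by (simp only: power2_norm_eq_inner)
qed

text \<open>The equation for \<open>w = ln v\<close>, in terms of the values at one point: \<open>V = v\<close>, \<open>m = |\<nabla>v|\<close>, \<open>gg = |\<nabla>w|\<^sup>2\<close>
  and \<open>Z = |\<nabla>v|\<^bsup>2-p\<^esup> \<Delta>\<^sub>p v\<close>.\<close>

lemma log_transformed_equation:
  fixes V m a l Z p q r b c T A gg :: real
  assumes V: "V > 0" and m: "m > 0"
    and pde: "m powr (p - 2) * Z + b * m powr q + c * V powr r = 0"
    and gg: "gg = m\<^sup>2 / V\<^sup>2"
  shows "Z / V + b * exp ((q - p + 1) * ln V + (q - p + 2) / 2 * ln gg)
      + c * exp ((r - p + 1) * ln V + (2 - p) / 2 * ln gg) = 0"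
proof -
  define a where "a = ln V"
  define l where "l = ln m"
  have lngg: "ln gg = 2 * (l - a)"
    using V m by (simp add: gg ln_div ln_realpow a_def l_def)
  have pde': "exp ((p - 2) * l) * Z + b * exp (q * l) + c * exp (r * a) = 0"
    using pde V m by (simp add: powr_def a_def l_def)
  have "Z / V = exp ((2 - p) * l - a) * (exp ((p - 2) * l) * Z)"
  proof -
    have "exp ((2 - p) * l - a) * exp ((p - 2) * l) = exp (- a)"
      by (simp add: exp_add[symmetric] algebra_simps)
    also have "\<dots> = 1 / V" using V by (simp add: a_def exp_minus inverse_eq_divide)
    finally show ?thesis by (simp add: mult.assoc[symmetric])
  qed
  moreover have "b * exp ((q - p + 1) * a + (q - p + 2) / 2 * (2 * (l - a))) = exp ((2 - p) * l - a) * (b * exp (q * l))"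
  proof -
    have "(q - p + 1) * a + (q - p + 2) / 2 * (2 * (l - a)) = ((2 - p) * l - a) + q * l" by (simp add: field_simps)
    then show ?thesis by (simp only: exp_add mult.left_commute)
  qed
  moreover have "c * exp ((r - p + 1) * a + (2 - p) / 2 * (2 * (l - a))) = exp ((2 - p) * l - a) * (c * exp (r * a))"
  proof -
    have "(r - p + 1) * a + (2 - p) / 2 * (2 * (l - a)) = ((2 - p) * l - a) + r * a" by (simp add: field_simps)
    then show ?thesis by (simp only: exp_add mult.left_commute)
  qed
  ultimately have "Z / V + b * exp ((q - p + 1) * a + (q - p + 2) / 2 * (2 * (l - a)))
      + c * exp ((r - p + 1) * a + (2 - p) / 2 * (2 * (l - a)))
      = exp ((2 - p) * l - a) * (exp ((p - 2) * l) * Z + b * exp (q * l) + c * exp (r * a))"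
    by (simp only: distrib_left)
  then show ?thesis unfolding pde' lngg a_def[symmetric] by simp
qed

lemma weak_solution_log_gradient_estimate:
  fixes v :: "'a::euclidean_space \<Rightarrow> real"
  assumes dim: "DIM('a) \<ge> 2" and p: "p > 1" and \<epsilon>: "\<epsilon> > 0" and K: "K \<ge> 0"
    and coer: "bernstein_coercive (real DIM('a)) p q r b c \<epsilon> K"
    and \<Omega>: "open \<Omega>" and v2: "Ck_on 2 v \<Omega>" and pos: "\<And>x. x \<in> \<Omega> \<Longrightarrow> v x > 0"
    and weak: "weak_solution p b c q r \<Omega> v"
    and \<rho>: "\<rho> > 0" and ball: "cball x0 \<rho> \<subseteq> \<Omega>"
  shows "(norm (grad (\<lambda>y. ln (v y)) x0))\<^sup>2 \<le> (14 * (real DIM('a) + p - 2) + 4 * K) / \<epsilon> / \<rho>\<^sup>2"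
proof -
  let ?G = "grad v"
  obtain Hv where G: "\<And>x. x \<in> \<Omega> \<Longrightarrow> (v has_derivative (\<lambda>k. ?G x \<bullet> k)) (at x)"
    and Hv: "\<And>x. x \<in> \<Omega> \<Longrightarrow> (?G has_derivative Hv x) (at x)"
    and Hvc: "\<And>u. continuous_on \<Omega> (\<lambda>x. Hv x u)"
    using C2_gradient_hessian[OF \<Omega> v2] by blast
  define g where "g x = inverse (v x) *\<^sub>R ?G x" for x
  define H where "H x u = inverse (v x) *\<^sub>R Hv x u - ((?G x \<bullet> u) / (v x)\<^sup>2) *\<^sub>R ?G x" for x u
  have vc: "continuous_on \<Omega> v" "continuous_on \<Omega> ?G"
    using G Hv by (auto intro!: continuous_at_imp_continuous_on intro: has_derivative_continuous)
  have w: "((\<lambda>y. ln (v y)) has_derivative (\<lambda>k. g x \<bullet> k)) (at x)" if "x \<in> \<Omega>" for x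
    using has_derivative_compose[OF G[OF that] DERIV_ln_divide[OF pos[OF that], unfolded has_field_derivative_def]]
    by (simp add: g_def divide_inverse mult.commute)
  have g: "(g has_derivative H x) (at x)" if "x \<in> \<Omega>" for x
  proof -
    have ne: "v x \<noteq> 0" using pos[OF that] by simp
    show ?thesis unfolding g_def[abs_def]
      by (rule has_derivative_eq_rhs[OF has_derivative_scaleR[OF has_derivative_compose[OF G[OF that]
              DERIV_inverse[OF ne, unfolded has_field_derivative_def]] Hv[OF that]]])
        (simp add: H_def fun_eq_iff divide_inverse power2_eq_square mult_ac)
  qed
  have Hc: "continuous_on \<Omega> (\<lambda>x. H x u)" for u
    unfolding H_def by (intro continuous_intros vc Hvc; use pos in force)
  have eq: "(\<Sum>i\<in>Basis. H x i \<bullet> i) + (p - 2) * (H x (g x) \<bullet> g x) / (norm (g x))\<^sup>2 + (p - 1) * (g x \<bullet> g x)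
      + b * exp ((q - p + 1) * ln (v x) + (q - p + 2) / 2 * ln (g x \<bullet> g x))
      + c * exp ((r - p + 1) * ln (v x) + (2 - p) / 2 * ln (g x \<bullet> g x)) = 0"
    if x: "x \<in> \<Omega>" and gx: "g x \<noteq> 0" for x
  proof -
    define V where "V = v x"
    define m where "m = norm (?G x)"
    define Tv where "Tv = (\<Sum>i\<in>Basis. Hv x i \<bullet> i)"
    define Av where "Av = Hv x (?G x) \<bullet> ?G x"
    have V: "V > 0" using pos[OF x] by (simp add: V_def)
    have G0: "?G x \<noteq> 0" using gx by (auto simp: g_def)
    have m: "m > 0" using G0 by (simp add: m_def)
    have GG: "?G x \<bullet> ?G x = m\<^sup>2" by (simp add: m_def power2_norm_eq_inner)
    have linv: "linear (Hv x)" using Hv[OF x] by (rule has_derivative_linear)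
    have gg: "g x \<bullet> g x = m\<^sup>2 / V\<^sup>2"
      using V by (simp add: g_def V_def[symmetric] GG divide_inverse power2_eq_square)
    have ng: "(norm (g x))\<^sup>2 = m\<^sup>2 / V\<^sup>2" using gg by (simp add: power2_norm_eq_inner)
    have T: "(\<Sum>i\<in>Basis. H x i \<bullet> i) = Tv / V - m\<^sup>2 / V\<^sup>2"
    proof -
      have "(\<Sum>i\<in>Basis. H x i \<bullet> i) = (\<Sum>i\<in>Basis. (Hv x i \<bullet> i) / V - (?G x \<bullet> i) * (?G x \<bullet> i) / V\<^sup>2)"
        by (simp add: H_def V_def[symmetric] inner_diff_left divide_inverse mult_ac)
      also have "\<dots> = Tv / V - m\<^sup>2 / V\<^sup>2"
        by (simp add: sum_subtractf sum_divide_distrib[symmetric] Tv_def euclidean_inner[symmetric] GG)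
      finally show ?thesis .
    qed
    have HG: "H x (?G x) \<bullet> ?G x = Av / V - m\<^sup>2 * m\<^sup>2 / V\<^sup>2"
      by (simp add: H_def V_def[symmetric] inner_diff_left GG Av_def divide_inverse mult_ac)
    have "linear (H x)" using g[OF x] by (rule has_derivative_linear)
    then have "H x (g x) \<bullet> g x = (H x (?G x) \<bullet> ?G x) / V\<^sup>2"
      by (simp add: g_def V_def[symmetric] linear_cmul divide_inverse power2_eq_square mult_ac)
    then have A: "(H x (g x) \<bullet> g x) / (norm (g x))\<^sup>2 = Av / m\<^sup>2 / V - m\<^sup>2 / V\<^sup>2"
      unfolding ng HG using V m by (simp add: field_simps)
    define Z where "Z = Tv + (p - 2) * Av / m\<^sup>2"
    have "m powr (p - 2) * Z + b * m powr q + c * V powr r = 0"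
      using weak_solution_pointwise[OF \<Omega> x G0 pos G Hv Hvc weak]
      by (simp add: Z_def Tv_def Av_def m_def V_def)
    from log_transformed_equation[OF V m this gg]
    have "Z / V + b * exp ((q - p + 1) * ln V + (q - p + 2) / 2 * ln (g x \<bullet> g x))
      + c * exp ((r - p + 1) * ln V + (2 - p) / 2 * ln (g x \<bullet> g x)) = 0" .
    moreover have "(\<Sum>i\<in>Basis. H x i \<bullet> i) + (p - 2) * (H x (g x) \<bullet> g x) / (norm (g x))\<^sup>2
        + (p - 1) * (g x \<bullet> g x) = Z / V"
      unfolding times_divide_eq_right[symmetric] A T gg Z_def
      by (simp add: algebra_simps add_divide_distrib diff_divide_distrib)
    ultimately show ?thesis unfolding V_def by simp
  qed
  have x0: "x0 \<in> \<Omega>" using ball \<rho> by auto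
  have "grad (\<lambda>y. ln (v y)) x0 = g x0" using w[OF x0] by (rule grad_eqI)
  with local_gradient_estimate[OF dim p \<epsilon> K coer \<Omega> \<rho> ball w g Hc eq] show ?thesis by simp
qed

section \<open>Distance to the boundary\<close>

lemma boundary_dist_cball:
  fixes x :: "'a::euclidean_space"
  assumes "x \<in> \<Omega>" "\<rho> > 0" "ereal \<rho> < boundary_dist \<Omega> x"
  shows "cball x \<rho> \<subseteq> \<Omega>"
proof (rule ccontr)
  assume "\<not> cball x \<rho> \<subseteq> \<Omega>"
  then have "cball x \<rho> - \<Omega> \<noteq> {}" by blast
  moreover have "cball x \<rho> \<inter> \<Omega> \<noteq> {}"
    using assms(1) centre_in_cball[of x \<rho>] less_imp_le[OF assms(2)] by blast
  ultimately have "cball x \<rho> \<inter> frontier \<Omega> \<noteq> {}"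
    by (intro connected_Int_frontier connected_cball)
  then obtain y where y: "y \<in> frontier \<Omega>" "dist x y \<le> \<rho>" by auto
  then have "boundary_dist \<Omega> x \<le> ereal (dist x y)"
    unfolding boundary_dist_def by (intro INF_lower)
  with y(2) assms(3) show False by (meson ereal_less_eq(3) leD order_trans)
qed

lemma boundary_dist_pos:
  assumes "open \<Omega>" "x \<in> \<Omega>"
  shows "boundary_dist \<Omega> x > 0"
proof -
  obtain e where e: "e > 0" "ball x e \<subseteq> \<Omega>" using assms open_contains_ball by blast
  have "ereal e \<le> boundary_dist \<Omega> x"
    unfolding boundary_dist_def
  proof (rule INF_greatest)
    fix y assume "y \<in> frontier \<Omega>"
    then have "y \<notin> \<Omega>" using assms(1) by (simp add: frontier_def interior_open)
    with e(2) show "ereal e \<le> ereal (dist x y)" by (auto simp: not_less[symmetric])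
  qed
  with e(1) show ?thesis by (metis ereal_less(2) less_le_trans)
qed

lemma le_inverse_boundary_dist:
  fixes x :: "'a::euclidean_space"
  assumes "open \<Omega>" "x \<in> \<Omega>" and C: "C \<ge> 0" and "a \<ge> 0"
    and bound: "\<And>\<rho>. \<rho> > 0 \<Longrightarrow> cball x \<rho> \<subseteq> \<Omega> \<Longrightarrow> a \<le> C / \<rho>"
  shows "ereal a \<le> ereal C * inverse (boundary_dist \<Omega> x)"
proof (cases "a = 0")
  case True
  have "0 \<le> ereal C * inverse (boundary_dist \<Omega> x)"
    using C boundary_dist_pos[OF assms(1,2)] by (cases "boundary_dist \<Omega> x") auto
  with True show ?thesis by (simp only: zero_ereal_def[symmetric])
next
  case False
  with assms(4) have a: "a > 0" by simp
  have le: "boundary_dist \<Omega> x \<le> ereal (C / a)"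
  proof (rule dense_le_bounded[OF boundary_dist_pos[OF assms(1,2)]])
    fix z assume z: "0 < z" "z < boundary_dist \<Omega> x"
    then obtain \<rho> where \<rho>: "z = ereal \<rho>" by (cases z) auto
    with z boundary_dist_cball[OF assms(2)] have "a \<le> C / \<rho>" "\<rho> > 0"
      using bound[of \<rho>] by auto
    then show "z \<le> ereal (C / a)" using a by (simp add: \<rho> field_simps)
  qed
  with boundary_dist_pos[OF assms(1,2)] obtain t where t: "boundary_dist \<Omega> x = ereal t" "t > 0"
    by (cases "boundary_dist \<Omega> x") auto
  with le a show ?thesis by (simp add: field_simps)
qed

section \<open>The gradient estimate\<close>

theorem corollary1p6:
  fixes p q r :: real
  assumes "CARD('n::finite) \<ge> 2" and "p > 1"
  shows "\<exists>C::real. \<forall>(b::real) (c::real) (\<Omega> :: (real ^ 'n) set) (v :: real ^ 'n \<Rightarrow> real).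
    b * c \<ge> 0 \<longrightarrow>
    (b, c, q, r) \<in> W1 (real CARD('n)) p \<union> W2 (real CARD('n)) p
                 \<union> W3 (real CARD('n)) p \<union> W4 (real CARD('n)) p \<longrightarrow>
    open \<Omega> \<longrightarrow> connected \<Omega> \<longrightarrow> \<Omega> \<noteq> {} \<longrightarrow>
    Ck_on 2 v \<Omega> \<longrightarrow> (\<forall>x\<in>\<Omega>. v x > 0) \<longrightarrow> weak_solution p b c q r \<Omega> v \<longrightarrow>
    (\<forall>x\<in>\<Omega>. ereal (norm (grad (\<lambda>y. ln (v y)) x)) \<le> ereal C * inverse (boundary_dist \<Omega> x))"
proof -
  let ?n = "real CARD('n)"
  have n: "?n > 1" and dim: "DIM(real ^ 'n) \<ge> 2" using assms(1) by auto
  from bernstein_coercivity[OF n assms(2), of q r] obtain \<epsilon> K where \<epsilon>: "\<epsilon> > 0" and K: "K \<ge> 0"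
    and coer: "\<And>b c. b * c \<ge> 0 \<Longrightarrow> (b, c, q, r) \<in> W1 ?n p \<union> W2 ?n p \<union> W3 ?n p \<union> W4 ?n p \<Longrightarrow>
      bernstein_coercive ?n p q r b c \<epsilon> K"
    by blast
  define C0 where "C0 = (14 * (?n + p - 2) + 4 * K) / \<epsilon>"
  have C0: "C0 \<ge> 0" using n assms(2) \<epsilon> K by (simp add: C0_def)
  show ?thesis
  proof (intro exI[of _ "sqrt C0"] allI impI ballI)
    fix b c :: real and \<Omega> :: "(real ^ 'n) set" and v :: "real ^ 'n \<Rightarrow> real" and x :: "real ^ 'n"
    assume bc: "b * c \<ge> 0"
      and W: "(b, c, q, r) \<in> W1 ?n p \<union> W2 ?n p \<union> W3 ?n p \<union> W4 ?n p"
      and \<Omega>: "open \<Omega>" and v: "Ck_on 2 v \<Omega>" "\<forall>x\<in>\<Omega>. v x > 0" and weak: "weak_solution p b c q r \<Omega> v"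
      and x: "x \<in> \<Omega>"
    show "ereal (norm (grad (\<lambda>y. ln (v y)) x)) \<le> ereal (sqrt C0) * inverse (boundary_dist \<Omega> x)"
    proof (rule le_inverse_boundary_dist[OF \<Omega> x])
      fix \<rho> :: real assume \<rho>: "\<rho> > 0" and ball: "cball x \<rho> \<subseteq> \<Omega>"
      have "(norm (grad (\<lambda>y. ln (v y)) x))\<^sup>2 \<le> (14 * (real DIM(real ^ 'n) + p - 2) + 4 * K) / \<epsilon> / \<rho>\<^sup>2"
      proof (rule weak_solution_log_gradient_estimate[OF dim assms(2) \<epsilon> K _ \<Omega> v(1) _ weak \<rho> ball])
        show "v x > 0" if "x \<in> \<Omega>" for x using v(2) that by blast
      qed (use coer[OF bc W] in simp)
      then have "(norm (grad (\<lambda>y. ln (v y)) x))\<^sup>2 \<le> C0 / \<rho>\<^sup>2" by (simp add: C0_def)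
      then have "sqrt ((norm (grad (\<lambda>y. ln (v y)) x))\<^sup>2) \<le> sqrt (C0 / \<rho>\<^sup>2)" by (rule real_sqrt_le_mono)
      then show "norm (grad (\<lambda>y. ln (v y)) x) \<le> sqrt C0 / \<rho>"
        using \<rho> by (simp add: real_sqrt_divide)
    qed (use C0 in auto)
  qed
qed

end
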